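(* Let $\nu$ be a lattice path from $(0,0)$ to $(b,a)$. The following posets are isomorphic: 1. the face poset of the $\nu$-associahedron; 2. the poset of $\nu$-Schröder trees; 3. the poset of $\nu$-Schröder paths.
   Context: A lattice path from $(0,0)$ to $(b,a)\in\mathbb{Z}_{\ge0}^2$ is a sequence of $a$ north steps $N=(0,1)$ and $b$ east steps $E=(1,0)$. The $\nu$-associahedron. Let $n=a+b+2$ and let $I\sqcup\overline J=[n]$ be the partition with $1\in I$, $n\in\overline J$, and for $2\le k\le n-1$, $k\in I$ if the $(k-1)$-st step of $\nu$ is $E$ and $k\in\overline J$ if it is $N$. An $(I,\overline J)$-forest is a subgraph of the complete bipartite graph with parts $I$ and $\overline J$ that is increasing (each arc $(i,\overline j)$, $i\in I$, $\overline j\in\overline J$, has $i<\overline j$) and non-crossing (no two arcs $(i,\overline j)$, $(i',\overline j')$ with $i<i'<\overline j<\overline j'$). A covering $(I,\overline J)$-forest is one containing the arc $(1,n)$ and with no isolated nodes. The poset of covering $(I,\overline J)$-forests is ordered by $T\le T'$ iff the arcs of $T'$ are a subset of the arcs of $T$. The face poset of a polyhedral complex is the poset of its non-empty faces ordered by inclusion. The $\nu$-associahedron $A_\nu$ is the polyhedral complex whose face poset is the poset of covering $(I,\overline J)$-forests. Trees. $R_\nu$ is the region weakly above $\nu$ inside the rectangle with corners $(0,0)$ and $(b,a)$. Two lattice points $p,q$ in $R_\nu$ are $\nu$-incompatible if $p$ is strictly southwest or strictly northeast of $q$ and the smallest rectangle containing $p$ and $q$ is contained in $R_\nu$; otherwise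 they are $\nu$-compatible. A $\nu$-Schröder tree is a set $T$ of pairwise $\nu$-compatible lattice points in $R_\nu$ which includes the point $(0,a)$ (the root) and such that each row and each column of the grid contains at least one point of $T$. The parent of a non-root point $p\in T$ is the nearest point of $T$ above $p$ in its column, or the nearest point of $T$ to the left of $p$ in its row, if one of these exists (both cannot exist); otherwise it is the unique point $q\in T$ strictly northwest of $p$ such that the box with opposite corners $p,q$ contains no other point of $T$. Contractions of a $\nu$-Schröder tree $S$: (right) if $q\in S$ has a point of $S$ above it in its column and a point of $S$ to its right in its row, remove $q$; (left) if $q\in S$ has a point of $S$ to its left in its row and a point of $S$ below it in its column, remove $q$; (diagonal) if $r\in S$ is strictly southeast of its parent $p$, with neither of the other two corners of the box determined by $p$ and $r$ in $S$, and $S\setminus\{r\}$ is a $\nu$-Schröder tree, remove $r$. The poset of $\nu$-Schröder trees has cover relation $T\prec T'$ iff $T'$ is a contraction of $T$. Paths. A $\nu$-Schröder path is a path from $(0,0)$ to $(b,a)$ with steps $N$, $E$, $D=(1,1)$ which stays weakly above $\nu$. For a lattice point $p$ of such a path, $\mathrm{horiz}_\nu(p)$ is the maximal number of east steps that can be placed starting at $p$ before crossing $\nu$ (while remaining in the smallest rectangle containing $\nu$). The (contraction) poset of $\nu$-Schröder paths has cover relation $\mu\prec\lambda$ iff $\lambda$ is obtained from $\mu$ by one of the following contractions: 1. Right contraction: replace a consecutive $EN$ pair with $D$. 2. Left contraction: let $q$ be the initial point of an $E$ step and let $r$ be the last lattice point of the path before $q$ with $\mathrm{horiz}_\nu(r)=\mathrm{horiz}_\nu(q)$;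 if the step starting at $r$ is an $N$ step, delete this $E$ step and this $N$ step, shift the subpath between the deleted steps one unit to the right, and place a $D$ step at $r$. 3. Diagonal contraction: let $r$ be a point which is the end point of an $E$ step and the initial point of a $D$ step, and let $s$ be the last lattice point of the path before $r$ with $\mathrm{horiz}_\nu(s)=\mathrm{horiz}_\nu(r)$; if the step starting at $s$ is an $N$ step, delete this $E$ step and this $N$ step, shift the subpath between the deleted steps one unit to the right, and place a $D$ step at $s$. *)

theory Defs
  imports "HOL-Analysis.Analysis"
begin

section \<open>Posets\<close>

text \<open>A poset is given by its carrier together with its (reflexive) order relation.\<close>

type_synonym 'a poset = "'a set \<times> 'a rel"

definition is_poset :: "'a poset \<Rightarrow> bool" where
  "is_poset P \<longleftrightarrow> snd P \<subseteq> fst P \<times> fst P \<and> partial_order_on (fst P) (snd P)"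

definition poset_isomorphic :: "'a poset \<Rightarrow> 'b poset \<Rightarrow> bool" where
  "poset_isomorphic P Q \<longleftrightarrow> is_poset P \<and> is_poset Q \<and>
     (\<exists>f. bij_betw f (fst P) (fst Q) \<and>
          (\<forall>x\<in>fst P. \<forall>y\<in>fst P. (x, y) \<in> snd P \<longleftrightarrow> (f x, f y) \<in> snd Q))"

definition poset_of_cover :: "'a set \<Rightarrow> ('a \<Rightarrow> 'a \<Rightarrow> bool) \<Rightarrow> 'a poset" where
  "poset_of_cover X c =
     (X, {(x, y). x \<in> X \<and> y \<in> X \<and> (x, y) \<in> {(u, v). u \<in> X \<and> v \<in> X \<and> c u v}\<^sup>*})"

section \<open>Lattice paths\<close>

datatype step = N | E | D

text \<open>A path starting at the origin is the list of its steps; points are pairs \<open>(x, y)\<close>.\<close>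

definition endpoint :: "step list \<Rightarrow> nat \<times> nat" where
  "endpoint w = (count_list w E + count_list w D, count_list w N + count_list w D)"

abbreviation point :: "step list \<Rightarrow> nat \<Rightarrow> nat \<times> nat" where
  "point w k \<equiv> endpoint (take k w)"

definition lattice_path :: "step list \<Rightarrow> nat \<Rightarrow> nat \<Rightarrow> bool" where
  "lattice_path \<nu> b a \<longleftrightarrow> set \<nu> \<subseteq> {N, E} \<and> endpoint \<nu> = (b, a)"

definition region :: "step list \<Rightarrow> (nat \<times> nat) set" where
  "region \<nu> = {(x, y). x \<le> fst (endpoint \<nu>) \<and> y \<le> snd (endpoint \<nu>) \<and>
     (\<exists>k\<le>length \<nu>. fst (point \<nu> k) = x \<and> snd (point \<nu> k) \<le> y)}"

text \<open>Lattice points of the smallest axis-parallel rectangle containing \<open>p\<close> and \<open>q\<close>.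
  Since the region above \<open>\<nu>\<close> is closed under moving north and west inside the bounding
  rectangle and \<open>\<nu>\<close> is a lattice path, a rectangle with lattice corners lies in the (real)
  region iff all its lattice points do.\<close>

definition rect :: "nat \<times> nat \<Rightarrow> nat \<times> nat \<Rightarrow> (nat \<times> nat) set" where
  "rect p q = {min (fst p) (fst q)..max (fst p) (fst q)} \<times>
              {min (snd p) (snd q)..max (snd p) (snd q)}"

section \<open>The \<open>\<nu>\<close>-associahedron\<close>

text \<open>The nodes are \<open>1, \<dots>, n\<close> with \<open>n = length \<nu> + 2\<close>; lists are indexed from \<open>0\<close>, so the
  \<open>(k - 1)\<close>-st step of \<open>\<nu>\<close> is \<open>\<nu> ! (k - 2)\<close>.\<close>

definition left_nodes :: "step list \<Rightarrow> nat set" where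
  "left_nodes \<nu> = insert 1 {k. 2 \<le> k \<and> k \<le> length \<nu> + 1 \<and> \<nu> ! (k - 2) = E}"

definition right_nodes :: "step list \<Rightarrow> nat set" where
  "right_nodes \<nu> = insert (length \<nu> + 2) {k. 2 \<le> k \<and> k \<le> length \<nu> + 1 \<and> \<nu> ! (k - 2) = N}"

text \<open>A forest is identified with its set of arcs, its nodes being all of \<open>1, \<dots>, n\<close>.\<close>

definition forest :: "step list \<Rightarrow> (nat \<times> nat) set \<Rightarrow> bool" where
  "forest \<nu> F \<longleftrightarrow> F \<subseteq> left_nodes \<nu> \<times> right_nodes \<nu> \<and>
     (\<forall>(i, j)\<in>F. i < j) \<and>
     \<not> (\<exists>(i, j)\<in>F. \<exists>(i', j')\<in>F. i < i' \<and> i' < j \<and> j < j')"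

definition covering_forest :: "step list \<Rightarrow> (nat \<times> nat) set \<Rightarrow> bool" where
  "covering_forest \<nu> F \<longleftrightarrow> forest \<nu> F \<and> (1, length \<nu> + 2) \<in> F \<and>
     (\<forall>i\<in>left_nodes \<nu>. \<exists>j. (i, j) \<in> F) \<and> (\<forall>j\<in>right_nodes \<nu>. \<exists>i. (i, j) \<in> F)"

definition forest_poset :: "step list \<Rightarrow> (nat \<times> nat) set poset" where
  "forest_poset \<nu> = ({F. covering_forest \<nu> F},
     {(F, F'). covering_forest \<nu> F \<and> covering_forest \<nu> F' \<and> F' \<subseteq> F})"

definition polyhedral_complex :: "'a::euclidean_space set set \<Rightarrow> bool" where
  "polyhedral_complex \<C> \<longleftrightarrow> finite \<C> \<and> (\<forall>S\<in>\<C>. polyhedron S) \<and>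
     (\<forall>F S. S \<in> \<C> \<and> F face_of S \<longrightarrow> F \<in> \<C>) \<and>
     (\<forall>S S'. S \<in> \<C> \<and> S' \<in> \<C> \<longrightarrow> (S \<inter> S') face_of S \<and> (S \<inter> S') face_of S')"

definition face_poset :: "'a::euclidean_space set set \<Rightarrow> 'a set poset" where
  "face_poset \<C> = (\<C> - {{}}, {(F, G). F \<in> \<C> - {{}} \<and> G \<in> \<C> - {{}} \<and> F \<subseteq> G})"

text \<open>The \<open>\<nu>\<close>-associahedron is determined only combinatorially; \<open>\<C>\<close> may be any of its geometric
  realizations.\<close>

definition nu_associahedron :: "step list \<Rightarrow> 'a::euclidean_space set set \<Rightarrow> bool" where
  "nu_associahedron \<nu> \<C> \<longleftrightarrow>
     polyhedral_complex \<C> \<and> poset_isomorphic (face_poset \<C>) (forest_poset \<nu>)"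

section \<open>\<open>\<nu>\<close>-Schroeder trees\<close>

definition strictly_sw :: "nat \<times> nat \<Rightarrow> nat \<times> nat \<Rightarrow> bool" where
  "strictly_sw p q \<longleftrightarrow> fst p < fst q \<and> snd p < snd q"

definition strictly_nw :: "nat \<times> nat \<Rightarrow> nat \<times> nat \<Rightarrow> bool" where
  "strictly_nw p q \<longleftrightarrow> fst p < fst q \<and> snd q < snd p"

definition incompatible :: "step list \<Rightarrow> nat \<times> nat \<Rightarrow> nat \<times> nat \<Rightarrow> bool" where
  "incompatible \<nu> p q \<longleftrightarrow> (strictly_sw p q \<or> strictly_sw q p) \<and> rect p q \<subseteq> region \<nu>"

definition schroeder_tree :: "step list \<Rightarrow> (nat \<times> nat) set \<Rightarrow> bool" where
  "schroeder_tree \<nu> T \<longleftrightarrow> T \<subseteq> region \<nu> \<and>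
     (\<forall>p\<in>T. \<forall>q\<in>T. \<not> incompatible \<nu> p q) \<and>
     (0, snd (endpoint \<nu>)) \<in> T \<and>
     (\<forall>x\<le>fst (endpoint \<nu>). \<exists>y. (x, y) \<in> T) \<and>
     (\<forall>y\<le>snd (endpoint \<nu>). \<exists>x. (x, y) \<in> T)"

definition above_in :: "(nat \<times> nat) set \<Rightarrow> nat \<times> nat \<Rightarrow> (nat \<times> nat) set" where
  "above_in T p = {q\<in>T. fst q = fst p \<and> snd p < snd q}"

definition below_in :: "(nat \<times> nat) set \<Rightarrow> nat \<times> nat \<Rightarrow> (nat \<times> nat) set" where
  "below_in T p = {q\<in>T. fst q = fst p \<and> snd q < snd p}"

definition left_in :: "(nat \<times> nat) set \<Rightarrow> nat \<times> nat \<Rightarrow> (nat \<times> nat) set" where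
  "left_in T p = {q\<in>T. snd q = snd p \<and> fst q < fst p}"

definition right_in :: "(nat \<times> nat) set \<Rightarrow> nat \<times> nat \<Rightarrow> (nat \<times> nat) set" where
  "right_in T p = {q\<in>T. snd q = snd p \<and> fst p < fst q}"

text \<open>\<open>is_parent T p r\<close>: the point \<open>p\<close> is the parent of \<open>r\<close> in \<open>T\<close>. For a Schroeder tree \<open>T\<close> at
  most one of the three cases applies, and it determines \<open>p\<close>.\<close>

definition is_parent :: "(nat \<times> nat) set \<Rightarrow> nat \<times> nat \<Rightarrow> nat \<times> nat \<Rightarrow> bool" where
  "is_parent T p r \<longleftrightarrow>
     (p \<in> above_in T r \<and> (\<forall>z\<in>above_in T r. snd p \<le> snd z)) \<or>
     (p \<in> left_in T r \<and> (\<forall>z\<in>left_in T r. fst z \<le> fst p)) \<or>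
     (above_in T r = {} \<and> left_in T r = {} \<and>
        p \<in> T \<and> strictly_nw p r \<and> rect p r \<inter> T \<subseteq> {p, r})"

definition tree_right_contraction :: "(nat \<times> nat) set \<Rightarrow> (nat \<times> nat) set \<Rightarrow> bool" where
  "tree_right_contraction S S' \<longleftrightarrow>
     (\<exists>q\<in>S. above_in S q \<noteq> {} \<and> right_in S q \<noteq> {} \<and> S' = S - {q})"

definition tree_left_contraction :: "(nat \<times> nat) set \<Rightarrow> (nat \<times> nat) set \<Rightarrow> bool" where
  "tree_left_contraction S S' \<longleftrightarrow>
     (\<exists>q\<in>S. left_in S q \<noteq> {} \<and> below_in S q \<noteq> {} \<and> S' = S - {q})"

definition tree_diagonal_contraction ::
  "step list \<Rightarrow> (nat \<times> nat) set \<Rightarrow> (nat \<times> nat) set \<Rightarrow> bool" where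
  "tree_diagonal_contraction \<nu> S S' \<longleftrightarrow>
     (\<exists>r\<in>S. \<exists>p\<in>S. is_parent S p r \<and> strictly_nw p r \<and>
        (fst p, snd r) \<notin> S \<and> (fst r, snd p) \<notin> S \<and>
        schroeder_tree \<nu> (S - {r}) \<and> S' = S - {r})"

definition tree_contraction :: "step list \<Rightarrow> (nat \<times> nat) set \<Rightarrow> (nat \<times> nat) set \<Rightarrow> bool" where
  "tree_contraction \<nu> S S' \<longleftrightarrow>
     tree_right_contraction S S' \<or> tree_left_contraction S S' \<or> tree_diagonal_contraction \<nu> S S'"

definition tree_poset :: "step list \<Rightarrow> (nat \<times> nat) set poset" where
  "tree_poset \<nu> = poset_of_cover {T. schroeder_tree \<nu> T} (tree_contraction \<nu>)"

section \<open>\<open>\<nu>\<close>-Schroeder paths\<close>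

text \<open>Each step has to stay weakly above \<open>\<nu>\<close>. For \<open>N\<close> and \<open>E\<close> steps this only concerns the two
  end points. A \<open>D\<close> step crosses the interior of a unit cell, so that cell must lie above \<open>\<nu>\<close>;
  it is not enough that its two end points do (consider \<open>\<nu> = NE\<close>).\<close>

definition schroeder_path :: "step list \<Rightarrow> step list \<Rightarrow> bool" where
  "schroeder_path \<nu> \<mu> \<longleftrightarrow> endpoint \<mu> = endpoint \<nu> \<and>
     (\<forall>k<length \<mu>. rect (point \<mu> k) (point \<mu> (Suc k)) \<subseteq> region \<nu>)"

definition horiz :: "step list \<Rightarrow> nat \<times> nat \<Rightarrow> nat" where
  "horiz \<nu> p = Max {k. \<forall>i\<le>k. (fst p + i, snd p) \<in> region \<nu>}"

text \<open>The \<open>j\<close>-th point of \<open>\<mu>\<close> is the last one before the \<open>k\<close>-th point with the same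
  horizontal distance.\<close>

definition last_same_horiz :: "step list \<Rightarrow> step list \<Rightarrow> nat \<Rightarrow> nat \<Rightarrow> bool" where
  "last_same_horiz \<nu> \<mu> j k \<longleftrightarrow> j < k \<and> horiz \<nu> (point \<mu> j) = horiz \<nu> (point \<mu> k) \<and>
     (\<forall>l. j < l \<and> l < k \<longrightarrow> horiz \<nu> (point \<mu> l) \<noteq> horiz \<nu> (point \<mu> k))"

definition path_right_contraction :: "step list \<Rightarrow> step list \<Rightarrow> bool" where
  "path_right_contraction \<mu> \<kappa> \<longleftrightarrow> (\<exists>u v. \<mu> = u @ [E, N] @ v \<and> \<kappa> = u @ [D] @ v)"

text \<open>Below, replacing the earlier \<open>N\<close> step by \<open>D\<close> and deleting the later \<open>E\<close> step shifts the
  subpath \<open>w\<close> between them one unit to the right.\<close>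

definition path_left_contraction :: "step list \<Rightarrow> step list \<Rightarrow> step list \<Rightarrow> bool" where
  "path_left_contraction \<nu> \<mu> \<kappa> \<longleftrightarrow>
     (\<exists>u w v. \<mu> = u @ [N] @ w @ [E] @ v \<and>
        last_same_horiz \<nu> \<mu> (length u) (length (u @ [N] @ w)) \<and>
        \<kappa> = u @ [D] @ w @ v)"

definition path_diagonal_contraction :: "step list \<Rightarrow> step list \<Rightarrow> step list \<Rightarrow> bool" where
  "path_diagonal_contraction \<nu> \<mu> \<kappa> \<longleftrightarrow>
     (\<exists>u w v. \<mu> = u @ [N] @ w @ [E, D] @ v \<and>
        last_same_horiz \<nu> \<mu> (length u) (length (u @ [N] @ w @ [E])) \<and>
        \<kappa> = u @ [D] @ w @ [D] @ v)"

definition path_contraction :: "step list \<Rightarrow> step list \<Rightarrow> step list \<Rightarrow> bool" where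
  "path_contraction \<nu> \<mu> \<kappa> \<longleftrightarrow>
     path_right_contraction \<mu> \<kappa> \<or> path_left_contraction \<nu> \<mu> \<kappa> \<or>
     path_diagonal_contraction \<nu> \<mu> \<kappa>"

definition path_poset :: "step list \<Rightarrow> step list poset" where
  "path_poset \<nu> = poset_of_cover {\<mu>. schroeder_path \<nu> \<mu>} (path_contraction \<nu>)"

end

theory Submission
  imports Defs
begin

text \<open>An arc \<open>(i, j)\<close> of a forest is the lattice point in the column of \<open>i\<close> and the row of \<open>j\<close>;
  crossing arcs become incompatible points. A path becomes a tree when it is scanned with a stack
  of columns: each path point yields the tree point in its own row and in the column on top of the
  stack. An \<open>E\<close> step pops a column, an \<open>N\<close> step pushes the columns that become available in the
  next row, and a \<open>D\<close> step does both. The height of the stack exceeds the horizontal distance of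
  the path point to \<open>\<nu>\<close> by one, so the last earlier point with the same horizontal distance is
  the last one at which the same stack height was seen. If an \<open>N\<close> step starts there, it yields the
  tree point next below in the same column. In this way every contraction of a path, just as every
  contraction of a tree, deletes a single tree point, and conversely a point can be deleted by a
  contraction as soon as what remains is a tree.\<close>

section \<open>Isomorphisms of posets generated by cover relations\<close>

text \<open>The order on trees is reversed inclusion: a set between two trees inherits compatibility
  from the larger one, the root and the occupied rows and columns from the smaller one, so it is a
  tree and points can be deleted one at a time. This is why it is enough to recognise each
  contraction as the deletion of one point. The scan is inverted step by step: the step leaving a
  tree point is \<open>E\<close> if the points not yet scanned use its row again, \<open>N\<close>
  if they use its column again, \<open>D\<close> if neither. Both at once would force two
  incompatible points, because the tree point just left is the southeast corner of the rectangle
  they span. The obstacle is that a left or diagonal contraction changes the stack during the whole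
  shifted subpath. The visited points nevertheless stay the same there, since between two moments of
  equal height the scan never looks at the part of the stack that has changed.\<close>

lemma poset_isomorphic_sym:
  assumes "poset_isomorphic P Q"
  shows "poset_isomorphic Q P"
proof -
  from assms obtain f where f: "is_poset P" "is_poset Q" "bij_betw f (fst P) (fst Q)"
    "\<forall>x\<in>fst P. \<forall>y\<in>fst P. (x, y) \<in> snd P \<longleftrightarrow> (f x, f y) \<in> snd Q"
    unfolding poset_isomorphic_def by blast
  let ?g = "the_inv_into (fst P) f"
  have g: "bij_betw ?g (fst Q) (fst P)"
    using f(3) by (rule bij_betw_the_inv_into)
  have "?g x \<in> fst P \<and> f (?g x) = x" if "x \<in> fst Q" for x
    using that f(3) g by (meson bij_betwE f_the_inv_into_f_bij_betw)
  then have "\<forall>x\<in>fst Q. \<forall>y\<in>fst Q. (x, y) \<in> snd Q \<longleftrightarrow> (?g x, ?g y) \<in> snd P"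
    using f(4) by metis
  then show ?thesis
    unfolding poset_isomorphic_def using f(1,2) g by blast
qed

lemma poset_isomorphic_trans:
  assumes "poset_isomorphic P Q" "poset_isomorphic Q R"
  shows "poset_isomorphic P R"
proof -
  from assms(1) obtain f where f: "is_poset P" "bij_betw f (fst P) (fst Q)"
    "\<forall>x\<in>fst P. \<forall>y\<in>fst P. (x, y) \<in> snd P \<longleftrightarrow> (f x, f y) \<in> snd Q"
    unfolding poset_isomorphic_def by blast
  from assms(2) obtain g where g: "is_poset R" "bij_betw g (fst Q) (fst R)"
    "\<forall>x\<in>fst Q. \<forall>y\<in>fst Q. (x, y) \<in> snd Q \<longleftrightarrow> (g x, g y) \<in> snd R"
    unfolding poset_isomorphic_def by blast
  have "bij_betw (g \<circ> f) (fst P) (fst R)"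
    using f(2) g(2) by (rule bij_betw_trans)
  moreover have "\<forall>x\<in>fst P. \<forall>y\<in>fst P. (x, y) \<in> snd P \<longleftrightarrow> ((g \<circ> f) x, (g \<circ> f) y) \<in> snd R"
    using f(2,3) g(3) by (simp add: bij_betwE)
  ultimately show ?thesis
    unfolding poset_isomorphic_def using f(1) g(1) by blast
qed

text \<open>Only antisymmetry is at stake: a measure that drops along every cover rules out cycles
  in the closure.\<close>

lemma is_poset_of_cover:
  fixes m :: "'a \<Rightarrow> nat"
  assumes "\<And>x y. x \<in> X \<Longrightarrow> y \<in> X \<Longrightarrow> c x y \<Longrightarrow> m y < m x"
  shows "is_poset (poset_of_cover X c)"
proof -
  let ?c = "{(u, v). u \<in> X \<and> v \<in> X \<and> c u v}"
  have decr: "x = y \<or> m y < m x" if "(x, y) \<in> ?c\<^sup>*" for x y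
    using that by induction (use assms in fastforce)+
  have "antisym {(x, y). x \<in> X \<and> y \<in> X \<and> (x, y) \<in> ?c\<^sup>*}"
  proof (rule antisymI)
    fix x y
    assume "(x, y) \<in> {(x, y). x \<in> X \<and> y \<in> X \<and> (x, y) \<in> ?c\<^sup>*}"
      "(y, x) \<in> {(x, y). x \<in> X \<and> y \<in> X \<and> (x, y) \<in> ?c\<^sup>*}"
    then have "(x, y) \<in> ?c\<^sup>*" "(y, x) \<in> ?c\<^sup>*" by auto
    from decr[OF this(1)] decr[OF this(2)] show "x = y" by auto
  qed
  moreover have "trans {(x, y). x \<in> X \<and> y \<in> X \<and> (x, y) \<in> ?c\<^sup>*}"
    by (rule transI) (auto intro: rtrancl_trans)
  ultimately show ?thesis
    unfolding is_poset_def poset_of_cover_def partial_order_on_def preorder_on_def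
    by (auto simp: refl_on_def)
qed

lemma rtrancl_image:
  assumes "(x, y) \<in> r\<^sup>*" and "\<And>u v. (u, v) \<in> r \<Longrightarrow> (f u, f v) \<in> s"
  shows "(f x, f y) \<in> s\<^sup>*"
  using assms(1) by induction (auto intro: rtrancl_into_rtrancl assms(2))

lemma poset_of_cover_isomorphic:
  assumes "is_poset (poset_of_cover X c)" "is_poset (poset_of_cover Y d)"
    and f: "bij_betw f X Y"
    and cd: "\<And>x y. x \<in> X \<Longrightarrow> y \<in> X \<Longrightarrow> c x y \<longleftrightarrow> d (f x) (f y)"
  shows "poset_isomorphic (poset_of_cover X c) (poset_of_cover Y d)"
proof -
  let ?c = "{(u, v). u \<in> X \<and> v \<in> X \<and> c u v}"
  let ?d = "{(u, v). u \<in> Y \<and> v \<in> Y \<and> d u v}"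
  let ?g = "the_inv_into X f"
  have g: "?g y \<in> X" "f (?g y) = y" if "y \<in> Y" for y
    using that f bij_betwE[OF bij_betw_the_inv_into[OF f]]
    by (auto simp: f_the_inv_into_f_bij_betw)
  have gf: "?g (f x) = x" if "x \<in> X" for x
    using that f by (simp add: bij_betw_def the_inv_into_f_f)
  have fY: "f x \<in> Y" if "x \<in> X" for x
    using that f by (rule bij_betwE[THEN bspec, rotated])
  have "(x, y) \<in> ?c\<^sup>* \<longleftrightarrow> (f x, f y) \<in> ?d\<^sup>*" if "x \<in> X" "y \<in> X" for x y
  proof
    assume "(x, y) \<in> ?c\<^sup>*"
    then show "(f x, f y) \<in> ?d\<^sup>*"
      by (rule rtrancl_image) (use fY cd in auto)
  next
    assume "(f x, f y) \<in> ?d\<^sup>*"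
    then have "(?g (f x), ?g (f y)) \<in> ?c\<^sup>*"
      by (rule rtrancl_image) (use g cd in auto)
    then show "(x, y) \<in> ?c\<^sup>*" using gf that by simp
  qed
  then show ?thesis
    using assms(1,2) f fY unfolding poset_isomorphic_def poset_of_cover_def by auto
qed

section \<open>The region above a lattice path\<close>

lemma endpoint_Nil [simp]: "endpoint [] = (0, 0)"
  by (simp add: endpoint_def)

lemma endpoint_Cons:
  "endpoint (s # u) = (fst (endpoint u) + (if s = N then 0 else 1),
     snd (endpoint u) + (if s = E then 0 else 1))"
  by (cases s) (auto simp: endpoint_def)

lemma endpoint_append:
  "endpoint (u @ v) = (fst (endpoint u) + fst (endpoint v), snd (endpoint u) + snd (endpoint v))"
  by (simp add: endpoint_def)

lemma point_Suc:
  assumes "k < length u"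
  shows "point u (Suc k) = (fst (point u k) + (if u ! k = N then 0 else 1),
     snd (point u k) + (if u ! k = E then 0 else 1))"
  using assms by (simp add: take_Suc_conv_app_nth endpoint_append endpoint_Cons)

lemma point_mono:
  assumes "k \<le> l"
  shows "fst (point u k) \<le> fst (point u l)" "snd (point u k) \<le> snd (point u l)"
proof -
  have "take l u = take k u @ take (l - k) (drop k u)"
    using assms by (metis le_add_diff_inverse take_add)
  then show "fst (point u k) \<le> fst (point u l)" "snd (point u k) \<le> snd (point u l)"
    by (simp_all add: endpoint_append)
qed

text \<open>A discrete intermediate value argument: one step raises the abscissa by at most
  1.\<close>

lemma point_reaches_column:
  assumes "x \<le> fst (point u k)" "k \<le> length u"
  shows "\<exists>l\<le>k. fst (point u l) = x"
  using assms
proof (induction k)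
  case (Suc k)
  show ?case
  proof (cases "x \<le> fst (point u k)")
    case True
    then show ?thesis using Suc by (meson Suc_leD le_Suc_eq)
  next
    case False
    then have "fst (point u (Suc k)) = x"
      using Suc.prems by (auto simp: point_Suc split: if_splits)
    then show ?thesis by blast
  qed
qed auto

lemma region_west:
  assumes "(x', y) \<in> region \<nu>" "x \<le> x'"
  shows "(x, y) \<in> region \<nu>"
proof -
  from assms(1) obtain k where k: "k \<le> length \<nu>" "fst (point \<nu> k) = x'" "snd (point \<nu> k) \<le> y"
    "x' \<le> fst (endpoint \<nu>)" "y \<le> snd (endpoint \<nu>)"
    by (auto simp: region_def)
  with assms(2) obtain l where "l \<le> k" "fst (point \<nu> l) = x"
    using point_reaches_column by blast
  with k assms(2) show ?thesis
    using point_mono(2)[of l k \<nu>] by (auto simp: region_def intro!: exI[of _ l])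
qed

lemma region_north:
  assumes "(x, y) \<in> region \<nu>" "y \<le> y'" "y' \<le> snd (endpoint \<nu>)"
  shows "(x, y') \<in> region \<nu>"
  using assms by (fastforce simp: region_def)

text \<open>The number \<open>w y\<close> is the largest abscissa of the region in row
  \<open>y\<close>. It replaces the region by an inequality, and \<open>mono_w\<close> expresses
  closure under moving north.\<close>

locale staircase =
  fixes \<nu> :: "step list" and w :: "nat \<Rightarrow> nat" and b a :: nat
  assumes mem_region: "(x, y) \<in> region \<nu> \<longleftrightarrow> y \<le> a \<and> x \<le> w y"
    and endpoint_nu: "endpoint \<nu> = (b, a)"
    and mono_w: "mono w"
    and w_top: "w a = b"

lemma staircase_exists:
  assumes "endpoint \<nu> = (b, a)"
  shows "\<exists>w. staircase \<nu> w b a"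
proof
  \<comment> \<open>Above row \<open>a\<close> the region is empty. Capping the row at
    \<open>a\<close> keeps the maximum meaningful there and makes \<open>w\<close> monotone on all
    naturals.\<close>
  define w where "w y = Max {x. (x, min y a) \<in> region \<nu>}" for y
  have fin: "finite {x. (x, y) \<in> region \<nu>}" for y
    by (rule finite_subset[of _ "{..b}"]) (auto simp: region_def assms)
  have zero: "(0, y) \<in> region \<nu>" if "y \<le> a" for y
    using that by (auto simp: region_def assms intro!: exI[of _ 0])
  have w_mem: "(w y, min y a) \<in> region \<nu>" for y
    using Max_in[OF fin, of "min y a"] zero[of "min y a"] unfolding w_def by auto
  have mem: "(x, y) \<in> region \<nu> \<longleftrightarrow> y \<le> a \<and> x \<le> w y" for x y
  proof
    assume "(x, y) \<in> region \<nu>"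
    moreover from this have "y \<le> a" by (auto simp: region_def assms)
    ultimately show "y \<le> a \<and> x \<le> w y"
      using Max_ge[OF fin] by (auto simp: w_def min_absorb1)
  next
    assume "y \<le> a \<and> x \<le> w y"
    then show "(x, y) \<in> region \<nu>"
      using region_west[OF w_mem, of x y] by (simp add: min_absorb1)
  qed
  have mono: "mono w"
  proof (rule monoI)
    fix y y' :: nat
    assume "y \<le> y'"
    then have "(w y, min y' a) \<in> region \<nu>"
      using region_north[OF w_mem[of y], of "min y' a"] by (auto simp: assms)
    then show "w y \<le> w y'"
      unfolding w_def[of y'] using Max_ge[OF fin] by simp
  qed
  have "(b, a) \<in> region \<nu>"
    by (auto simp: region_def assms intro!: exI[of _ "length \<nu>"])
  moreover have "w a \<le> b"
    using w_mem[of a] by (auto simp: region_def assms)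
  ultimately have "w a = b" using mem by auto
  then show "staircase \<nu> w b a"
    using mem mono assms by unfold_locales auto
qed

section \<open>Scanning a path with a stack of columns\<close>

context staircase
begin

text \<open>These columns enter the region between rows \<open>y\<close> and \<open>Suc y\<close>.
  They are listed in decreasing order so that pushing them keeps the rightmost column on
  top.\<close>

definition fresh :: "nat \<Rightarrow> nat list" where
  "fresh y = rev [Suc (w y)..<Suc (w (Suc y))]"

lemma set_fresh [simp]: "set (fresh y) = {w y<..w (Suc y)}"
  by (auto simp: fresh_def)

lemma length_fresh [simp]: "length (fresh y) = w (Suc y) - w y"
  by (simp add: fresh_def del: upt_Suc)

lemma w_le_Suc: "w y \<le> w (Suc y)"
  using mono_w by (simp add: monoD)

lemma w_le_top: "y \<le> a \<Longrightarrow> w y \<le> b"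
  using mono_w w_top by (metis monoD)

fun advance :: "step \<Rightarrow> nat list \<times> nat \<Rightarrow> nat list \<times> nat" where
  "advance E (st, y) = (tl st, y)"
| "advance N (st, y) = (fresh y @ st, Suc y)"
| "advance D (st, y) = (fresh y @ tl st, Suc y)"

abbreviation run :: "step list \<Rightarrow> nat list \<times> nat \<Rightarrow> nat list \<times> nat" where
  "run \<equiv> fold advance"

text \<open>The bottom of a good stack is column 0, which must never be popped. By the height
  invariant \<open>length_run\<close>, a height of at least 2 says that the path point has room for
  one step east; for \<open>D\<close> this puts the southeast corner of the crossed cell into the
  region.\<close>

fun fits :: "step \<Rightarrow> nat list \<times> nat \<Rightarrow> bool" where
  "fits E (st, y) \<longleftrightarrow> 2 \<le> length st"
| "fits N (st, y) \<longleftrightarrow> y < a"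
| "fits D (st, y) \<longleftrightarrow> y < a \<and> 2 \<le> length st"

fun fitting :: "step list \<Rightarrow> nat list \<times> nat \<Rightarrow> bool" where
  "fitting [] s \<longleftrightarrow> True"
| "fitting (x # u) s \<longleftrightarrow> fits x s \<and> fitting u (advance x s)"

definition admissible :: "step list \<Rightarrow> nat list \<times> nat \<Rightarrow> bool" where
  "admissible u s \<longleftrightarrow> fitting u s \<and> length (fst (run u s)) = 1 \<and> snd (run u s) = a"

definition node :: "nat list \<times> nat \<Rightarrow> nat \<times> nat" where
  "node s = (hd (fst s), snd s)"

text \<open>The node of the final state is left out, so that a concatenation gives a union without
  overlap at the seam; \<open>tree_of\<close> adds it.\<close>

fun visited :: "step list \<Rightarrow> nat list \<times> nat \<Rightarrow> (nat \<times> nat) set" where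
  "visited [] s = {}"
| "visited (x # u) s = insert (node s) (visited u (advance x s))"

definition tree_of :: "step list \<Rightarrow> nat list \<times> nat \<Rightarrow> (nat \<times> nat) set" where
  "tree_of u s = insert (node (run u s)) (visited u s)"

text \<open>The stack holds, from right to left, the columns still available for points of the tree in
  the current row or above it; columns to the right of the region in this row are pushed later.\<close>

definition good :: "nat list \<times> nat \<Rightarrow> bool" where
  "good s \<longleftrightarrow> sorted_wrt (>) (fst s) \<and> 0 \<in> set (fst s) \<and>
     (\<forall>c\<in>set (fst s). c \<le> w (snd s)) \<and> snd s \<le> a"

definition start :: "nat list \<times> nat" where
  "start = (rev [0..<Suc (w 0)], 0)"

lemma good_start: "good start"
  unfolding good_def start_def by (auto simp: sorted_wrt_rev)

lemma sorted_fresh: "sorted_wrt (>) (fresh y)"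
  unfolding fresh_def by (simp add: sorted_wrt_rev del: upt_Suc)

lemma good_E: "good (c # st, y) \<Longrightarrow> st \<noteq> [] \<Longrightarrow> good (st, y)"
  by (cases st) (auto simp: good_def)

lemma good_push:
  assumes "good (st, y)" "y < a"
  shows "good (fresh y @ st, Suc y)"
  using assms w_le_Suc[of y] unfolding good_def
  by (auto simp: sorted_wrt_append sorted_fresh intro: order_trans le_less_trans)

lemma good_nonempty: "good s \<Longrightarrow> fst s \<noteq> []"
  by (auto simp: good_def)

lemma good_cases:
  assumes "good s"
  obtains c st y where "s = (c # st, y)"
  using good_nonempty[OF assms] by (metis prod.collapse list.exhaust)

lemma good_advance:
  assumes "good s" "fits x s"
  shows "good (advance x s)"
proof -
  obtain c st y where s: "s = (c # st, y)"
    using good_cases[OF assms(1)] .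
  have "good (st, y)" if "2 \<le> length (c # st)"
    using good_E[of c st y] assms(1) that s by fastforce
  then show ?thesis
    using assms good_push unfolding s by (cases x) auto
qed

lemma fitting_append: "fitting (u @ v) s \<longleftrightarrow> fitting u s \<and> fitting v (run u s)"
  by (induction u arbitrary: s) auto

lemma good_run: "good s \<Longrightarrow> fitting u s \<Longrightarrow> good (run u s)"
  by (induction u arbitrary: s) (simp_all add: good_advance)

lemma admissible_append: "admissible (u @ v) s \<longleftrightarrow> fitting u s \<and> admissible v (run u s)"
  by (auto simp: admissible_def fitting_append)

lemma admissible_Cons [simp]: "admissible (x # u) s \<longleftrightarrow> fits x s \<and> admissible u (advance x s)"
  by (auto simp: admissible_def)

lemma admissible_Nil [simp]: "admissible [] s \<longleftrightarrow> length (fst s) = 1 \<and> snd s = a"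
  by (auto simp: admissible_def)

lemma visited_append: "visited (u @ v) s = visited u s \<union> visited v (run u s)"
  by (induction u arbitrary: s) auto

lemma tree_of_append: "tree_of (u @ v) s = visited u s \<union> tree_of v (run u s)"
  by (auto simp: tree_of_def visited_append)

lemma tree_of_Nil [simp]: "tree_of [] s = {node s}"
  by (simp add: tree_of_def)

lemma tree_of_Cons [simp]: "tree_of (x # u) s = insert (node s) (tree_of u (advance x s))"
  by (auto simp: tree_of_def)

lemma node_Cons [simp]: "node (c # st, y) = (c, y)"
  by (simp add: node_def)

lemma finite_tree_of: "finite (tree_of u s)"
  by (induction u arbitrary: s) auto

subsection \<open>Stack height and horizontal distance\<close>

lemma snd_run: "snd (run u s) = snd s + snd (endpoint u)"
proof (induction u arbitrary: s)
  case (Cons x u)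
  then show ?case by (cases x; cases s) (auto simp: endpoint_Cons)
qed simp

text \<open>Here \<open>x\<close> is the abscissa of the path point at which the scan is in state
  \<open>s\<close>. Height plus abscissa stays equal to \<open>Suc (w y)\<close>: a pop is balanced
  by the step east, and a push adds exactly the growth of \<open>w\<close>.\<close>

lemma length_run:
  assumes "good s" "fitting u s" "length (fst s) + x = Suc (w (snd s))"
  shows "length (fst (run u s)) + (x + fst (endpoint u)) = Suc (w (snd (run u s)))"
  using assms
proof (induction u arbitrary: s x)
  case (Cons z u)
  obtain c st y where s: "s = (c # st, y)"
    using good_cases[OF Cons.prems(1)] .
  have "good (advance z s)" "fitting u (advance z s)"
    using Cons.prems by (auto intro: good_advance)
  moreover have "length (fst (advance z s)) + (x + (if z = N then 0 else 1))
      = Suc (w (snd (advance z s)))"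
    using Cons.prems w_le_Suc[of y] unfolding s by (cases z) auto
  ultimately show ?case
    using Cons.IH[of "advance z s" "x + (if z = N then 0 else 1)"]
    by (auto simp: endpoint_Cons add.commute add.left_commute)
qed simp

lemma horiz_eq:
  assumes "x \<le> w y" "y \<le> a"
  shows "horiz \<nu> (x, y) = w y - x"
proof -
  have "{k. \<forall>i\<le>k. (fst (x, y) + i, snd (x, y)) \<in> region \<nu>} = {..w y - x}"
    using assms by (auto simp: mem_region)
  moreover have "Max {..w y - x} = w y - x"
    by (rule Max_eqI) auto
  ultimately show ?thesis by (simp add: horiz_def)
qed

lemma horiz_endpoint:
  assumes "fitting u start"
  shows "Suc (horiz \<nu> (endpoint u)) = length (fst (run u start))"
proof -
  have "length (fst (run u start)) + fst (endpoint u) = Suc (w (snd (endpoint u)))"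
    using length_run[OF good_start assms, of 0] snd_run[of u start] by (simp add: start_def)
  moreover have good: "good (run u start)"
    using good_run[OF good_start assms] .
  then have "0 < length (fst (run u start))" "snd (endpoint u) \<le> a"
    using good_nonempty snd_run[of u start] by (auto simp: start_def good_def)
  moreover from calculation have "fst (endpoint u) \<le> w (snd (endpoint u))"
    by linarith
  ultimately show ?thesis
    using horiz_eq[of "fst (endpoint u)" "snd (endpoint u)"] by simp
qed

section \<open>Paths above \<nu> as admissible scans\<close>

text \<open>The region is closed under moving west and north, so the southeast corner decides, apart
  from the height bound.\<close>

lemma rect_subset_region:
  assumes "x \<le> x'" "y \<le> y'"
  shows "rect (x, y) (x', y') \<subseteq> region \<nu> \<longleftrightarrow> y' \<le> a \<and> x' \<le> w y"
proof
  assume "rect (x, y) (x', y') \<subseteq> region \<nu>"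
  moreover have "(x', y') \<in> rect (x, y) (x', y')" "(x', y) \<in> rect (x, y) (x', y')"
    using assms by (auto simp: rect_def)
  ultimately show "y' \<le> a \<and> x' \<le> w y" using mem_region by blast
next
  assume "y' \<le> a \<and> x' \<le> w y"
  then show "rect (x, y) (x', y') \<subseteq> region \<nu>"
    using assms monoD[OF mono_w, of y] by (fastforce simp: rect_def mem_region)
qed

text \<open>The induction needs paths that begin anywhere. The hypothesis on the height ties the
  offset \<open>x\<close> to the state, so that legality of each step can be read off the
  stack.\<close>

lemma schroeder_path_shifted:
  assumes "good s" "length (fst s) + x = Suc (w (snd s))"
  shows "(x + fst (endpoint u), snd s + snd (endpoint u)) = (b, a) \<and>
      (\<forall>k<length u. rect (x + fst (point u k), snd s + snd (point u k))
         (x + fst (point u (Suc k)), snd s + snd (point u (Suc k))) \<subseteq> region \<nu>)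
    \<longleftrightarrow> admissible u s"
  using assms
proof (induction u arbitrary: s x)
  case Nil
  then show ?case using w_top by (auto simp: good_def)
next
  case (Cons z u)
  obtain c st y where s: "s = (c # st, y)"
    using good_cases[OF Cons.prems(1)] .
  let ?dx = "if z = N then 0 else 1 :: nat" and ?dy = "if z = E then 0 else 1 :: nat"
  have y: "y \<le> a" using Cons.prems by (simp add: s good_def)
  have first: "rect (x, y) (x + ?dx, y + ?dy) \<subseteq> region \<nu> \<longleftrightarrow> fits z s"
    using Cons.prems y by (subst rect_subset_region) (cases z; auto simp: s)+
  have split: "(\<forall>k<length (z # u). P k) \<longleftrightarrow> P 0 \<and> (\<forall>k<length u. P (Suc k))" for P
    by (auto simp: less_Suc_eq_0_disj)
  show ?case
  proof (cases "fits z s")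
    case False
    then show ?thesis
      using first unfolding split by (auto simp: s endpoint_Cons)
  next
    case True
    have len: "length (fst (advance z s)) + (x + ?dx) = Suc (w (snd (advance z s)))"
      using True Cons.prems w_le_Suc[of y] unfolding s by (cases z) auto
    have snd: "snd (advance z s) = y + ?dy"
      unfolding s by (cases z) auto
    show ?thesis
      using Cons.IH[OF good_advance[OF Cons.prems(1) True] len] True first
      unfolding split snd by (simp add: s endpoint_Cons ac_simps)
  qed
qed

lemma schroeder_path_iff_admissible: "schroeder_path \<nu> u \<longleftrightarrow> admissible u start"
  using schroeder_path_shifted[OF good_start, of 0 u] endpoint_nu
  by (simp add: schroeder_path_def start_def)

section \<open>Paths and trees\<close>

text \<open>The trees that complete a scan in state \<open>s\<close>.\<close>

definition partial_tree :: "nat list \<times> nat \<Rightarrow> (nat \<times> nat) set \<Rightarrow> bool" where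
  "partial_tree s T \<longleftrightarrow>
     (\<forall>(x, y)\<in>T. snd s \<le> y \<and> y \<le> a \<and> x \<le> w y \<and> (x \<in> set (fst s) \<or> w (snd s) < x)) \<and>
     (\<forall>(x, y)\<in>T. \<forall>(x', y')\<in>T. x < x' \<longrightarrow> y < y' \<longrightarrow> w y < x') \<and>
     (0, a) \<in> T \<and>
     (\<forall>x. x \<in> set (fst s) \<or> w (snd s) < x \<and> x \<le> b \<longrightarrow> (\<exists>y. (x, y) \<in> T)) \<and>
     (\<forall>y. snd s \<le> y \<and> y \<le> a \<longrightarrow> (\<exists>x. (x, y) \<in> T))"

lemma partial_treeD:
  assumes "partial_tree s T"
  shows "(x, y) \<in> T \<Longrightarrow> snd s \<le> y" "(x, y) \<in> T \<Longrightarrow> y \<le> a" "(x, y) \<in> T \<Longrightarrow> x \<le> w y"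
    "(x, y) \<in> T \<Longrightarrow> x \<in> set (fst s) \<or> w (snd s) < x"
    "(x, y) \<in> T \<Longrightarrow> (x', y') \<in> T \<Longrightarrow> x < x' \<Longrightarrow> y < y' \<Longrightarrow> w y < x'"
    "(0, a) \<in> T" "x \<in> set (fst s) \<Longrightarrow> \<exists>y. (x, y) \<in> T"
    "w (snd s) < x \<Longrightarrow> x \<le> b \<Longrightarrow> \<exists>y. (x, y) \<in> T"
    "snd s \<le> y \<Longrightarrow> y \<le> a \<Longrightarrow> \<exists>x. (x, y) \<in> T"
  using assms unfolding partial_tree_def by blast+

lemma partial_treeI:
  assumes "\<And>x y. (x, y) \<in> T \<Longrightarrow>
      snd s \<le> y \<and> y \<le> a \<and> x \<le> w y \<and> (x \<in> set (fst s) \<or> w (snd s) < x)"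
    and "\<And>x y x' y'. (x, y) \<in> T \<Longrightarrow> (x', y') \<in> T \<Longrightarrow> x < x' \<Longrightarrow> y < y' \<Longrightarrow> w y < x'"
    and "(0, a) \<in> T"
    and "\<And>x. x \<in> set (fst s) \<or> w (snd s) < x \<and> x \<le> b \<Longrightarrow> \<exists>y. (x, y) \<in> T"
    and "\<And>y. snd s \<le> y \<Longrightarrow> y \<le> a \<Longrightarrow> \<exists>x. (x, y) \<in> T"
  shows "partial_tree s T"
  using assms unfolding partial_tree_def by (intro conjI) blast+

lemma incompatible_iff:
  assumes "(x, y) \<in> region \<nu>" "(x', y') \<in> region \<nu>"
  shows "incompatible \<nu> (x, y) (x', y') \<longleftrightarrow>
    x < x' \<and> y < y' \<and> x' \<le> w y \<or> x' < x \<and> y' < y \<and> x \<le> w y'"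
proof -
  have "rect (x, y) (x', y') = rect (x', y') (x, y)"
    by (simp add: rect_def min.commute max.commute)
  moreover have "incompatible \<nu> (x, y) (x', y') \<longleftrightarrow>
      (x < x' \<and> y < y' \<or> x' < x \<and> y' < y) \<and> rect (x, y) (x', y') \<subseteq> region \<nu>"
    by (simp add: incompatible_def strictly_sw_def)
  moreover have "rect (x, y) (x', y') \<subseteq> region \<nu> \<longleftrightarrow> x' \<le> w y" if "x < x'" "y < y'"
    using rect_subset_region[of x x' y y'] assms(2) that by (simp add: mem_region)
  moreover have "rect (x', y') (x, y) \<subseteq> region \<nu> \<longleftrightarrow> x \<le> w y'" if "x' < x" "y' < y"
    using rect_subset_region[of x' x y' y] assms(1) that by (simp add: mem_region)
  ultimately show ?thesis by metis
qed

text \<open>The initial stack holds every column up to \<open>w 0\<close>, so the restriction to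
  available columns is void at the start.\<close>

lemma schroeder_tree_iff: "schroeder_tree \<nu> T \<longleftrightarrow> partial_tree start T"
proof
  assume "schroeder_tree \<nu> T"
  then have T: "T \<subseteq> region \<nu>" "\<And>p q. p \<in> T \<Longrightarrow> q \<in> T \<Longrightarrow> \<not> incompatible \<nu> p q" "(0, a) \<in> T"
    "\<And>x. x \<le> b \<Longrightarrow> \<exists>y. (x, y) \<in> T" "\<And>y. y \<le> a \<Longrightarrow> \<exists>x. (x, y) \<in> T"
    using endpoint_nu by (auto simp: schroeder_tree_def)
  show "partial_tree start T"
  proof (rule partial_treeI)
    show "snd start \<le> y \<and> y \<le> a \<and> x \<le> w y \<and> (x \<in> set (fst start) \<or> w (snd start) < x)"
      if "(x, y) \<in> T" for x y
      using T(1) that mem_region[of x y] by (auto simp: start_def simp del: upt_Suc)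
    show "w y < x'" if "(x, y) \<in> T" "(x', y') \<in> T" "x < x'" "y < y'" for x y x' y'
    proof -
      have "(x, y) \<in> region \<nu>" "(x', y') \<in> region \<nu>" using T(1) that by auto
      from incompatible_iff[OF this] show ?thesis using T(2)[OF that(1,2)] that(3,4) by auto
    qed
    show "\<exists>y. (x, y) \<in> T" if "x \<in> set (fst start) \<or> w (snd start) < x \<and> x \<le> b" for x
      using T(4)[of x] that w_le_top[of 0] by (auto simp: start_def simp del: upt_Suc)
  qed (use T in auto)
next
  assume "partial_tree start T"
  note T = partial_treeD[OF this]
  have reg: "(x, y) \<in> region \<nu>" if "(x, y) \<in> T" for x y
    using T(2,3)[OF that] by (simp add: mem_region)
  have "\<not> incompatible \<nu> (x, y) (x', y')" if "(x, y) \<in> T" "(x', y') \<in> T" for x y x' y'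
    using incompatible_iff[OF reg[OF that(1)] reg[OF that(2)]] T(5)[OF that] T(5)[OF that(2,1)]
    by auto
  then have "\<forall>p\<in>T. \<forall>q\<in>T. \<not> incompatible \<nu> p q"
    by (metis surj_pair)
  moreover have "\<exists>y. (x, y) \<in> T" if "x \<le> b" for x
    using T(7,8)[of x] that by (cases "x \<le> w 0") (auto simp: start_def simp del: upt_Suc)
  moreover have "\<exists>x. (x, y) \<in> T" if "y \<le> a" for y
    using T(9)[of y] that by (simp add: start_def)
  ultimately show "schroeder_tree \<nu> T"
    using T(6) reg endpoint_nu by (simp add: schroeder_tree_def subset_iff)
qed

lemma good_ConsD:
  assumes "good (c # st, y)"
  shows "c \<le> w y" "y \<le> a" "\<And>x. x \<in> set st \<Longrightarrow> x < c" "c \<notin> set st" "0 \<in> set (c # st)"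
  using assms by (auto simp: good_def)

text \<open>Prepending a step adds the node of the current state, which closes its row or its column
  where the remaining tree no longer does.\<close>

lemma partial_tree_insert:
  assumes "good s" "fits x s" "partial_tree (advance x s) T"
  shows "partial_tree s (insert (node s) T)"
proof -
  obtain c st y where s: "s = (c # st, y)"
    using good_cases[OF assms(1)] .
  note g = good_ConsD[OF assms(1)[unfolded s]]
  obtain st' y' where s': "advance x s = (st', y')" by fastforce
  have y': "y' = (if x = E then y else Suc y)" "x \<noteq> E \<Longrightarrow> y < a"
    using assms(2) s' s by (cases x; auto)+
  have mem: "z \<in> set st' \<or> w y' < z \<longleftrightarrow> (if x = N then z \<in> set (c # st) else z \<in> set st) \<or> w y < z" for z
    using s' s w_le_Suc[of y] by (cases x) auto
  have col: "p \<in> set st \<or> w y < p \<or> p = c" if "p \<in> set st' \<or> w y' < p" for p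
    using that unfolding mem by (auto split: if_splits)
  note T = partial_treeD[OF assms(3)[unfolded s'], unfolded fst_conv snd_conv]
  have bounds: "y \<le> q \<and> q \<le> a \<and> p \<le> w q \<and> (p \<in> set (c # st) \<or> w y < p)"
    if "(p, q) \<in> T" for p q
    using T(1-4)[OF that] y' col[of p] by (cases "x = E") auto
  \<comment> \<open>\<open>c\<close> is the largest column on the stack, so anything further east is
    not yet pushed. This is exactly compatibility with \<open>(c, y)\<close>.\<close>
  have east: "w y < p" if "(p, q) \<in> T" "c < p" for p q
    using bounds[OF that(1)] g(3)[of p] that(2) by fastforce
  have compat: "w q < p'"
    if "(p, q) \<in> insert (c, y) T" "(p', q') \<in> insert (c, y) T" "p < p'" "q < q'" for p q p' q'
  proof (cases "(p, q) = (c, y)")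
    case True
    then show ?thesis using that east[of p' q'] by auto
  next
    case False
    then have pq: "(p, q) \<in> T" using that(1) by auto
    then have "(p', q') \<in> T" using that(2,4) bounds[OF pq] by auto
    then show ?thesis using T(5)[OF pq] that(3,4) by blast
  qed
  have cols: "\<exists>q. (p, q) \<in> insert (c, y) T" if "p \<in> set (c # st) \<or> w y < p \<and> p \<le> b" for p
  proof (cases "p = c")
    case False
    then have "p \<in> set st' \<or> w y' < p"
      using that mem[of p] by (auto split: if_splits)
    moreover have "p \<le> b"
      using that g(1,2) g(3)[of p] w_le_top[of y] by fastforce
    ultimately show ?thesis using T(7,8)[of p] by blast
  qed auto
  have rows: "\<exists>p. (p, q) \<in> insert (c, y) T" if "y \<le> q" "q \<le> a" for q
  proof (cases "q = y")
    case False
    then have "y' \<le> q" using that y' by auto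
    then show ?thesis using T(9)[of q] that by blast
  qed auto
  have "partial_tree (c # st, y) (insert (c, y) T)"
  proof (rule partial_treeI)
    show "(0, a) \<in> insert (c, y) T" using T(6) by blast
  qed (use bounds compat cols rows g in auto)
  then show ?thesis by (simp add: s)
qed

lemma partial_tree_tree_of:
  assumes "good s" "admissible u s"
  shows "partial_tree s (tree_of u s)"
  using assms
proof (induction u arbitrary: s)
  case Nil
  then obtain c where s: "s = ([c], a)"
    by (cases s) (auto simp: length_Suc_conv)
  with Nil have "c = 0" by (auto simp: good_def)
  then show ?case using s w_top by (auto simp: partial_tree_def)
next
  case (Cons x u)
  then show ?case
    using partial_tree_insert[of s x] good_advance[of s x] by simp
qed

section \<open>Decoding a path from its tree\<close>

text \<open>\<open>N\<close> and \<open>D\<close> leave row \<open>y\<close> for good.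
  \<open>E\<close> and \<open>D\<close> pop \<open>c\<close>, which cannot return because only
  columns beyond \<open>w y\<close> are pushed later. Conversely, a row or column still open must be
  occupied.\<close>

lemma partial_tree_above:
  assumes "good (c # st, y)" "fits x (c # st, y)" "partial_tree (advance x (c # st, y)) T"
  shows "(c, y) \<notin> T" "x = E \<longleftrightarrow> (\<exists>p. (p, y) \<in> T)" "x = N \<longleftrightarrow> (\<exists>q. (c, q) \<in> T)"
proof -
  note g = good_ConsD[OF assms(1)] and T = partial_treeD[OF assms(3)]
  have row: "(p, y) \<notin> T" if "x \<noteq> E" for p
    using T(1)[of p y] that by (cases x) auto
  have col: "(c, q) \<notin> T" if "x \<noteq> N" for q
    using T(4)[of c q] that g(1,4) w_le_Suc[of y] by (cases x) auto
  show "(c, y) \<notin> T" using row[of c] col[of y] by blast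
  show "x = E \<longleftrightarrow> (\<exists>p. (p, y) \<in> T)"
    using row T(9)[of y] g(2) by (cases "x = E") auto
  show "x = N \<longleftrightarrow> (\<exists>q. (c, q) \<in> T)"
    using col T(7)[of c] by (cases "x = N") auto
qed

text \<open>The top point can be cancelled from both trees because it does not recur, and then the
  remainder determines the first step. No step fits a state of height 1 in row \<open>a\<close>,
  which settles the empty path.\<close>

lemma tree_of_inj:
  assumes "good s" "admissible u s" "admissible v s" "tree_of u s = tree_of v s"
  shows "u = v"
  using assms
proof (induction u arbitrary: s v)
  case Nil
  then have s: "length (fst s) = 1" "snd s = a" by auto
  then have "\<not> fits x s" for x by (cases s; cases x) auto
  then show ?case using Nil by (cases v) auto
next
  case (Cons x u)
  obtain c st y where s: "s = (c # st, y)"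
    using good_cases[OF Cons.prems(1)] .
  obtain z v' where v: "v = z # v'"
  proof (cases v)
    case Nil
    with Cons.prems have "length (fst s) = 1" "snd s = a" by auto
    then have "\<not> fits x s" by (cases s; cases x) auto
    then show ?thesis using Cons.prems by simp
  qed
  let ?T = "tree_of u (advance x s)" and ?T' = "tree_of v' (advance z s)"
  have fits: "fits x s" "fits z s" using Cons.prems v by auto
  have good: "good (advance x s)" "good (advance z s)"
    using Cons.prems(1) fits good_advance by auto
  have pt: "partial_tree (advance x s) ?T" "partial_tree (advance z s) ?T'"
    using good Cons.prems v partial_tree_tree_of by auto
  have "insert (c, y) ?T = insert (c, y) ?T'"
    using Cons.prems(4) by (simp add: v s)
  moreover note ab = partial_tree_above[OF Cons.prems(1)[unfolded s] fits(1)[unfolded s] pt(1)[unfolded s]]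
    partial_tree_above[OF Cons.prems(1)[unfolded s] fits(2)[unfolded s] pt(2)[unfolded s]]
  ultimately have eq: "?T = ?T'"
    unfolding s by (simp add: insert_ident)
  with ab have "x = E \<longleftrightarrow> z = E" "x = N \<longleftrightarrow> z = N"
    unfolding s by auto
  then have "x = z" by (cases x; cases z) auto
  then show ?case using Cons.IH[OF good(1)] Cons.prems v eq by auto
qed

section \<open>Every tree comes from a path\<close>

text \<open>Otherwise row \<open>y\<close> and column \<open>c\<close> would be occupied by a point
  to the left and a point above, and these are incompatible because \<open>(c, y)\<close> lies in
  the region.\<close>

lemma partial_tree_top:
  assumes "good (c # st, y)" "partial_tree (c # st, y) T"
  shows "(c, y) \<in> T"
proof (rule ccontr)
  assume c: "(c, y) \<notin> T"
  note g = good_ConsD[OF assms(1)]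
  note T = partial_treeD[OF assms(2), unfolded fst_conv snd_conv]
  obtain q where q: "(c, q) \<in> T"
    using T(7)[of c] by auto
  obtain p where p: "(p, y) \<in> T"
    using T(9)[of y] g(2) by auto
  have "p \<noteq> c" "q \<noteq> y" using c p q by auto
  moreover have "p \<in> set (c # st)" "y \<le> q"
    using T(3,4)[OF p] T(1)[OF q] by auto
  ultimately have "p < c" "y < q" using g by auto
  then have "w y < c" using T(5)[OF p q] by simp
  then show False using g by simp
qed

text \<open>The step is chosen by what remains: \<open>E\<close> if row \<open>y\<close> still has a
  point, \<open>N\<close> if only column \<open>c\<close> has one, \<open>D\<close> if neither
  has.\<close>

lemma partial_tree_remove:
  assumes g: "good (c # st, y)" and T: "partial_tree (c # st, y) T" and z: "(c, y) \<noteq> (0, a)"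
  shows "\<exists>x. fits x (c # st, y) \<and> partial_tree (advance x (c # st, y)) (T - {(c, y)})"
proof -
  note g' = good_ConsD[OF g] and top = partial_tree_top[OF g T]
    and T' = partial_treeD[OF T, unfolded fst_conv snd_conv]
  let ?T = "T - {(c, y)}"
  have root: "(0, a) \<in> ?T" using T'(6) z by auto
  have bounds: "y \<le> q \<and> q \<le> a \<and> p \<le> w q \<and> (p \<in> set (c # st) \<or> w y < p)"
    if "(p, q) \<in> T" for p q using T'(1-4)[OF that] by blast
  have cols: "\<exists>q. (p, q) \<in> ?T" if "p \<in> set st \<or> w y < p \<and> p \<le> b" for p
  proof -
    have "p \<noteq> c" using that g'(1,4) by auto
    then show ?thesis using that T'(7)[of p] T'(8)[of p] by auto
  qed
  have rows: "\<exists>p. (p, q) \<in> ?T" if "y < q" "q \<le> a" for q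
    using T'(9)[of q] that by auto
  \<comment> \<open>The root survives in column 0, so an exhausted column \<open>c\<close> is not 0,
    and 0 lies further down the stack.\<close>
  have st: "st \<noteq> []" if "\<not> (\<exists>q. (c, q) \<in> ?T)"
    using that root g'(5) by auto
  have remove: "partial_tree (st', y') ?T"
    if "\<And>p q. (p, q) \<in> ?T \<Longrightarrow> y' \<le> q \<and> (p \<in> set st' \<or> w y' < p)"
      "\<And>p. p \<in> set st' \<or> w y' < p \<and> p \<le> b \<Longrightarrow> \<exists>q. (p, q) \<in> ?T"
      "\<And>q. y' \<le> q \<Longrightarrow> q \<le> a \<Longrightarrow> \<exists>p. (p, q) \<in> ?T" for st' y'
  proof (rule partial_treeI)
    show "w q < p'" if "(p, q) \<in> ?T" "(p', q') \<in> ?T" "p < p'" "q < q'" for p q p' q'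
      using T'(5)[of p q p' q'] that by blast
  qed (use that bounds root in \<open>simp_all only: fst_conv snd_conv, auto\<close>)
  have push: "w y < p \<and> p \<le> b" if "p \<in> set (fresh y) \<or> w (Suc y) < p \<and> p \<le> b" "y < a" for p
    using that w_le_Suc[of y] w_le_top[of "Suc y"] by auto
  consider p where "(p, y) \<in> ?T" | q where "\<not> (\<exists>p. (p, y) \<in> ?T)" "(c, q) \<in> ?T"
    | "\<not> (\<exists>p. (p, y) \<in> ?T)" "\<not> (\<exists>q. (c, q) \<in> ?T)" by blast
  then show ?thesis
  proof cases
    case 1
    then have p: "p \<in> set st" using bounds[of p y] by auto
    have c: "(c, q) \<notin> ?T" for q
    proof
      assume q: "(c, q) \<in> ?T"
      then have "y < q" using bounds[of c q] by auto
      then have "w y < c" using T'(5)[of p y c q] 1 q g'(3)[OF p] by auto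
      then show False using g' by simp
    qed
    have "partial_tree (st, y) ?T"
    proof (rule remove)
      show "y \<le> q' \<and> (p' \<in> set st \<or> w y < p')" if "(p', q') \<in> ?T" for p' q'
        using bounds[of p' q'] that c[of q'] by auto
      show "\<exists>p'. (p', q) \<in> ?T" if "y \<le> q" "q \<le> a" for q
        using rows[of q] that 1 by (cases "q = y") auto
    qed (fact cols)
    moreover have "fits E (c # st, y)" using p by (cases st) auto
    ultimately show ?thesis by (intro exI[of _ E]) simp
  next
    case 2
    then have "y < q" using bounds[of c q] by auto
    then have ya: "y < a" using bounds[of c q] 2 by auto
    have "partial_tree (fresh y @ c # st, Suc y) ?T"
    proof (rule remove)
      show "Suc y \<le> q' \<and> (p' \<in> set (fresh y @ c # st) \<or> w (Suc y) < p')"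
        if "(p', q') \<in> ?T" for p' q'
      proof -
        have "q' \<noteq> y" using that 2 by auto
        then show ?thesis using that bounds[of p' q'] by auto
      qed
      show "\<exists>q'. (p', q') \<in> ?T"
        if "p' \<in> set (fresh y @ c # st) \<or> w (Suc y) < p' \<and> p' \<le> b" for p'
        using that cols[of p'] push[of p'] 2(2) ya by (cases "p' = c") auto
      show "\<exists>p. (p, q') \<in> ?T" if "Suc y \<le> q'" "q' \<le> a" for q'
        using rows[of q'] that by simp
    qed
    then show ?thesis using ya by (intro exI[of _ N]) simp
  next
    case 3
    have ya: "y < a" using root 3 g'(2) by (cases "y = a") auto
    have "partial_tree (fresh y @ st, Suc y) ?T"
    proof (rule remove)
      show "Suc y \<le> q' \<and> (p' \<in> set (fresh y @ st) \<or> w (Suc y) < p')"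
        if "(p', q') \<in> ?T" for p' q'
      proof -
        have "q' \<noteq> y" "p' \<noteq> c" using that 3 by auto
        then show ?thesis using that bounds[of p' q'] by auto
      qed
      show "\<exists>q'. (p', q') \<in> ?T"
        if "p' \<in> set (fresh y @ st) \<or> w (Suc y) < p' \<and> p' \<le> b" for p'
        using that cols[of p'] push[of p'] ya by auto
      show "\<exists>p. (p, q') \<in> ?T" if "Suc y \<le> q'" "q' \<le> a" for q'
        using rows[of q'] that by simp
    qed
    moreover have "2 \<le> length (c # st)" using st[OF 3(2)] by (cases st) auto
    ultimately show ?thesis using ya by (intro exI[of _ D]) simp
  qed
qed

lemma finite_partial_tree:
  assumes "partial_tree s T"
  shows "finite T"
proof (rule finite_subset)
  show "T \<subseteq> {..b} \<times> {..a}"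
  proof (rule subrelI)
    fix x y
    assume "(x, y) \<in> T"
    then have "x \<le> w y" "y \<le> a" using partial_treeD(2,3)[OF assms] by blast+
    then show "(x, y) \<in> {..b} \<times> {..a}" using w_le_top[of y] by simp
  qed
qed simp

lemma partial_tree_root:
  assumes "good (0 # st, a)" "partial_tree (0 # st, a) T"
  shows "st = []" "T = {(0, a)}"
proof -
  show st: "st = []" using assms(1) by (cases st) (auto simp: good_def)
  have "p = 0 \<and> q = a" if "(p, q) \<in> T" for p q
    using partial_treeD(1-4)[OF assms(2) that] st by auto
  then have "T \<subseteq> {(0, a)}" by (intro subrelI) blast
  then show "T = {(0, a)}" using partial_tree_top[OF assms] by blast
qed

text \<open>Peeling off the top point spells the path one step at a time; only the root remains when
  the top point is the root.\<close>

lemma tree_of_surj: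
  assumes "good s" "partial_tree s T"
  shows "\<exists>u. admissible u s \<and> tree_of u s = T"
  using assms
proof (induction "card T" arbitrary: s T)
  case 0
  then show ?case using finite_partial_tree[of s T] by (auto simp: partial_tree_def)
next
  case (Suc n)
  obtain c st y where s: "s = (c # st, y)"
    using good_cases[OF Suc.prems(1)] .
  note top = partial_tree_top[OF Suc.prems[unfolded s]]
  show ?case
  proof (cases "(c, y) = (0, a)")
    case True
    then show ?thesis
      using partial_tree_root[of st T] Suc.prems s by (intro exI[of _ "[]"]) auto
  next
    case False
    from partial_tree_remove[OF Suc.prems[unfolded s] this] obtain x
      where x: "fits x s" "partial_tree (advance x s) (T - {(c, y)})" unfolding s by blast
    have "n = card (T - {(c, y)})"
      using Suc.hyps(2) top finite_partial_tree[OF Suc.prems(2)] by simp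
    from Suc.hyps(1)[OF this good_advance[OF Suc.prems(1) x(1)] x(2)] obtain u
      where "admissible u (advance x s)" "tree_of u (advance x s) = T - {(c, y)}" by blast
    then show ?thesis
      using x(1) top by (intro exI[of _ "x # u"]) (auto simp: s)
  qed
qed

text \<open>No point is visited twice. Later this turns the loss of one letter under a contraction
  into the loss of exactly one point.\<close>

lemma card_tree_of:
  assumes "good s" "admissible u s"
  shows "card (tree_of u s) = Suc (length u)"
  using assms
proof (induction u arbitrary: s)
  case (Cons x u)
  obtain c st y where s: "s = (c # st, y)"
    using good_cases[OF Cons.prems(1)] .
  have good: "good (advance x s)" using Cons.prems good_advance by auto
  then have "partial_tree (advance x s) (tree_of u (advance x s))"
    using Cons.prems partial_tree_tree_of by auto
  then have "(c, y) \<notin> tree_of u (advance x s)"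
    using partial_tree_above(1) Cons.prems unfolding s by auto
  then show ?case using Cons good finite_tree_of by (simp add: s)
qed simp

lemma bij_betw_tree_of:
  "bij_betw (\<lambda>u. tree_of u start) {u. schroeder_path \<nu> u} {T. schroeder_tree \<nu> T}"
proof (rule bij_betw_imageI)
  show "inj_on (\<lambda>u. tree_of u start) {u. schroeder_path \<nu> u}"
  proof (rule inj_onI)
    fix u v
    assume "u \<in> {u. schroeder_path \<nu> u}" "v \<in> {u. schroeder_path \<nu> u}"
      "tree_of u start = tree_of v start"
    then show "u = v"
      using tree_of_inj[OF good_start, of u v] by (simp add: schroeder_path_iff_admissible)
  qed
  show "(\<lambda>u. tree_of u start) ` {u. schroeder_path \<nu> u} = {T. schroeder_tree \<nu> T}"
  proof (intro equalityI subsetI)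
    fix T
    assume "T \<in> {T. schroeder_tree \<nu> T}"
    then obtain u where "admissible u start" "tree_of u start = T"
      using tree_of_surj[OF good_start] by (auto simp: schroeder_tree_iff)
    then show "T \<in> (\<lambda>u. tree_of u start) ` {u. schroeder_path \<nu> u}"
      by (auto simp: schroeder_path_iff_admissible)
  qed (use partial_tree_tree_of[OF good_start] in
      \<open>auto simp: schroeder_path_iff_admissible schroeder_tree_iff\<close>)
qed

section \<open>Contractions of paths remove tree points\<close>

lemma fitting_take: "fitting u s \<Longrightarrow> fitting (take l u) s"
  by (metis append_take_drop_id fitting_append)

text \<open>A step pops at most one entry, so the scan cannot get below \<open>st\<close> without
  first meeting it. Until then every node comes from the block above, and \<open>st\<close> may be
  exchanged for \<open>st'\<close>; it has to be nonempty so that popping from a block of height 1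
  stays legal.\<close>

lemma run_above:
  assumes "\<And>l. l < length u \<Longrightarrow> fst (run (take l u) (A @ st, y)) \<noteq> st"
  shows "\<exists>B y'. run u (A @ st, y) = (B @ st, y') \<and> run u (A @ st', y) = (B @ st', y') \<and>
    visited u (A @ st', y) = visited u (A @ st, y) \<and>
    (fitting u (A @ st, y) \<longrightarrow> st' \<noteq> [] \<longrightarrow> fitting u (A @ st', y)) \<and>
    (\<forall>l<length u. length st < length (fst (run (take l u) (A @ st, y))))"
  using assms
proof (induction u arbitrary: A y)
  case (Cons x u)
  have "A \<noteq> []" using Cons.prems[of 0] by auto
  then obtain d A' where A: "A = d # A'" by (cases A) auto
  obtain A2 y2 where adv: "advance x (A @ ss, y) = (A2 @ ss, y2)" for ss
    using A by (cases x) auto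
  have fits: "fits x (A @ st, y) \<longrightarrow> st' \<noteq> [] \<longrightarrow> fits x (A @ st', y)"
    using A by (cases x; cases st') auto
  have "fst (run (take l u) (A2 @ st, y2)) \<noteq> st" if "l < length u" for l
    using Cons.prems[of "Suc l"] that by (simp add: adv)
  from Cons.IH[OF this] obtain B y' where IH:
    "run u (A2 @ st, y2) = (B @ st, y')" "run u (A2 @ st', y2) = (B @ st', y')"
    "visited u (A2 @ st', y2) = visited u (A2 @ st, y2)"
    "fitting u (A2 @ st, y2) \<longrightarrow> st' \<noteq> [] \<longrightarrow> fitting u (A2 @ st', y2)"
    "\<forall>l<length u. length st < length (fst (run (take l u) (A2 @ st, y2)))"
    by blast
  have node: "node (A @ st', y) = node (A @ st, y)" by (simp add: A)
  have "length st < length (fst (run (take l (x # u)) (A @ st, y)))" if "l < length (x # u)" for l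
    using IH(5) that \<open>A \<noteq> []\<close> by (cases l) (auto simp: adv)
  then show ?case
    using IH(1-4) fits node by (intro exI[of _ B] exI[of _ y']) (simp add: adv)
qed auto

text \<open>Since heights and horizontal distances differ by the constant 1, the condition says that
  the scan regains its height before the \<open>N\<close> step at the end of \<open>v\<close> and
  not earlier.\<close>

lemma last_same_horiz_iff:
  assumes "admissible (u @ N # v @ z) start"
  shows "last_same_horiz \<nu> (u @ N # v @ z) (length u) (length (u @ N # v)) \<longleftrightarrow>
    length (fst (run (u @ N # v) start)) = length (fst (run u start)) \<and>
    (\<forall>l<length v. length (fst (run (u @ N # take l v) start)) \<noteq> length (fst (run u start)))"
proof -
  let ?m = "u @ N # v @ z"
  have "fitting ?m start" using assms by (simp add: admissible_def)
  from horiz_endpoint[OF fitting_take[OF this]]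
  have h: "horiz \<nu> (point ?m j) = horiz \<nu> (point ?m k) \<longleftrightarrow>
      length (fst (run (take j ?m) start)) = length (fst (run (take k ?m) start))" for j k
    by (metis Suc_inject)
  have between: "(\<forall>l. length u < l \<and> l < length (u @ N # v) \<longrightarrow> P (take l ?m)) \<longleftrightarrow>
      (\<forall>l<length v. P (u @ N # take l v))" for P
  proof (intro iffI allI impI)
    fix l
    assume "\<forall>l. length u < l \<and> l < length (u @ N # v) \<longrightarrow> P (take l ?m)" "l < length v"
    then show "P (u @ N # take l v)"
      by (auto dest!: spec[of _ "Suc (length u + l)"])
  next
    fix l
    assume P: "\<forall>l<length v. P (u @ N # take l v)" and l: "length u < l \<and> l < length (u @ N # v)"
    then obtain k where "l = Suc (length u + k)" by (metis add_Suc_right less_imp_Suc_add)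
    then show "P (take l ?m)" using P l by auto
  qed
  show ?thesis
    unfolding last_same_horiz_def h
      between[of "\<lambda>p. length (fst (run p start)) \<noteq> length (fst (run (take (length (u @ N # v)) ?m) start))"]
    by auto
qed

text \<open>\<open>E\<close> followed by \<open>N\<close> acts on the stack exactly like
  \<open>D\<close>; only the node between the two steps is lost.\<close>

lemma right_contraction:
  assumes "admissible (u @ [E, N] @ v) start"
  shows "admissible (u @ [D] @ v) start"
    "tree_of (u @ [E, N] @ v) start = insert (node (run (u @ [E]) start)) (tree_of (u @ [D] @ v) start)"
proof -
  have f: "fitting u start" "admissible (E # N # v) (run u start)"
    using assms by (auto simp: admissible_append)
  obtain c st y where s: "run u start = (c # st, y)"
    using good_cases[OF good_run[OF good_start f(1)]] .
  moreover from f(2) obtain d st' where "st = d # st'"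
    by (cases st) (auto simp: s)
  ultimately show "admissible (u @ [D] @ v) start"
    "tree_of (u @ [E, N] @ v) start = insert (node (run (u @ [E]) start)) (tree_of (u @ [D] @ v) start)"
    using f by (auto simp: admissible_append tree_of_append)
qed

text \<open>Column \<open>c\<close> stays buried while \<open>v\<close> is scanned, resurfaces, and
  is then popped by \<open>E\<close>. Popping it at once with \<open>D\<close> changes nothing in
  between, so the lost point is the one at which \<open>c\<close> resurfaces.\<close>

lemma left_contraction:
  assumes m: "admissible (u @ [N] @ v @ [E] @ z) start"
    and last: "last_same_horiz \<nu> (u @ [N] @ v @ [E] @ z) (length u) (length (u @ [N] @ v))"
  shows "admissible (u @ [D] @ v @ z) start"
    "tree_of (u @ [N] @ v @ [E] @ z) start =
       insert (node (run (u @ [N] @ v) start)) (tree_of (u @ [D] @ v @ z) start)"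
proof -
  have f: "fitting u start" "admissible (N # v @ E # z) (run u start)"
    using m by (auto simp: admissible_append)
  obtain c st y where s: "run u start = (c # st, y)"
    using good_cases[OF good_run[OF good_start f(1)]] .
  let ?s = "(fresh y @ c # st, Suc y)"
  have "length (fst (run v ?s)) = Suc (length st)"
    and ne: "\<And>l. l < length v \<Longrightarrow> length (fst (run (take l v) ?s)) \<noteq> Suc (length st)"
    using last last_same_horiz_iff[of u v "E # z"] m s by auto
  moreover from ne have "fst (run (take l v) ?s) \<noteq> c # st" if "l < length v" for l
    using that by fastforce
  from run_above[OF this, of st] obtain B y' where
    "run v ?s = (B @ c # st, y')" "run v (fresh y @ st, Suc y) = (B @ st, y')"
    "visited v (fresh y @ st, Suc y) = visited v ?s"
    "fitting v ?s \<longrightarrow> st \<noteq> [] \<longrightarrow> fitting v (fresh y @ st, Suc y)" by blast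
  ultimately have B: "run v ?s = (c # st, y')" "run v (fresh y @ st, Suc y) = (st, y')"
    "visited v (fresh y @ st, Suc y) = visited v ?s"
    "fitting v ?s \<longrightarrow> st \<noteq> [] \<longrightarrow> fitting v (fresh y @ st, Suc y)" by auto
  have f': "y < a" "fitting v ?s" "2 \<le> length (c # st)" "admissible z (st, y')"
    using f(2) by (auto simp: s B admissible_append)
  then have "st \<noteq> []" by auto
  with f(1) f' B(4) show "admissible (u @ [D] @ v @ z) start"
    by (simp add: admissible_append s B(2))
  show "tree_of (u @ [N] @ v @ [E] @ z) start =
       insert (node (run (u @ [N] @ v) start)) (tree_of (u @ [D] @ v @ z) start)"
    by (auto simp: tree_of_append s B)
qed

text \<open>As for the left contraction, but \<open>c\<close> resurfaces only after the
  \<open>E\<close> step. In the new path the final \<open>D\<close> pops the column that this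
  \<open>E\<close> used to pop, since \<open>c\<close> is already gone.\<close>

lemma diagonal_contraction:
  assumes m: "admissible (u @ [N] @ v @ [E, D] @ z) start"
    and last: "last_same_horiz \<nu> (u @ [N] @ v @ [E, D] @ z) (length u) (length (u @ [N] @ v @ [E]))"
  shows "admissible (u @ [D] @ v @ [D] @ z) start"
    "tree_of (u @ [N] @ v @ [E, D] @ z) start =
       insert (node (run (u @ [N] @ v @ [E]) start)) (tree_of (u @ [D] @ v @ [D] @ z) start)"
proof -
  have f: "fitting u start" "admissible (N # v @ E # D # z) (run u start)"
    using m by (auto simp: admissible_append)
  obtain c st y where s: "run u start = (c # st, y)"
    using good_cases[OF good_run[OF good_start f(1)]] .
  let ?s = "(fresh y @ c # st, Suc y)"
  have len: "length (fst (run (v @ [E]) ?s)) = Suc (length st)"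
    and ne: "\<And>l. l < length (v @ [E]) \<Longrightarrow>
      length (fst (run (take l (v @ [E])) ?s)) \<noteq> Suc (length st)"
    using last last_same_horiz_iff[of u "v @ [E]" "D # z"] m s by auto
  have "fst (run (take l v) ?s) \<noteq> c # st" if "l < length v" for l
    using that ne[of l] by fastforce
  from run_above[OF this, of st] obtain B y' where B:
    "run v ?s = (B @ c # st, y')" "run v (fresh y @ st, Suc y) = (B @ st, y')"
    "visited v (fresh y @ st, Suc y) = visited v ?s"
    "fitting v ?s \<longrightarrow> st \<noteq> [] \<longrightarrow> fitting v (fresh y @ st, Suc y)" by blast
  \<comment> \<open>After the \<open>E\<close> step the height agrees with that of
    \<open>c # st\<close>, and by \<open>ne\<close> it did not agree just before; so exactly one
    entry lies above \<open>c\<close> at the end of \<open>v\<close>.\<close>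
  have "length B = 1" using len ne[of "length v"] B(1) by (cases B) auto
  then obtain d where d: "B = [d]" by (auto simp: length_Suc_conv)
  have f': "y < a" "fitting v ?s" "2 \<le> length (c # st)" "y' < a" "admissible z (fresh y' @ st, Suc y')"
    using f(2) by (auto simp: s B d admissible_append)
  then have "st \<noteq> []" by auto
  with f(1) f' B(4) show "admissible (u @ [D] @ v @ [D] @ z) start"
    by (simp add: admissible_append s B(2) d)
  show "tree_of (u @ [N] @ v @ [E, D] @ z) start =
       insert (node (run (u @ [N] @ v @ [E]) start)) (tree_of (u @ [D] @ v @ [D] @ z) start)"
    by (auto simp: tree_of_append s B d)
qed

lemma path_contraction_removes:
  assumes "admissible u start" "path_contraction \<nu> u v"
  shows "\<exists>q\<in>tree_of u start. tree_of v start = tree_of u start - {q}"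
proof -
  have "admissible v start \<and> length u = Suc (length v) \<and>
      (\<exists>q. tree_of u start = insert q (tree_of v start))"
    using assms(2) unfolding path_contraction_def
  proof (elim disjE)
    assume "path_right_contraction u v"
    then obtain u1 z where eq: "u = u1 @ [E, N] @ z" "v = u1 @ [D] @ z"
      unfolding path_right_contraction_def by blast
    have "length u = Suc (length v)" by (simp add: eq(1,2))
    then show ?thesis
      using right_contraction[OF assms(1)[unfolded eq(1)]] unfolding eq(1,2) by blast
  next
    assume "path_left_contraction \<nu> u v"
    then obtain u1 v1 z where eq: "u = u1 @ [N] @ v1 @ [E] @ z" "v = u1 @ [D] @ v1 @ z"
      "last_same_horiz \<nu> u (length u1) (length (u1 @ [N] @ v1))"
      unfolding path_left_contraction_def by blast
    have "length u = Suc (length v)" by (simp add: eq(1,2))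
    then show ?thesis
      using left_contraction[OF assms(1)[unfolded eq(1)] eq(3)[unfolded eq(1)]] unfolding eq(1,2) by blast
  next
    assume "path_diagonal_contraction \<nu> u v"
    then obtain u1 v1 z where eq: "u = u1 @ [N] @ v1 @ [E, D] @ z" "v = u1 @ [D] @ v1 @ [D] @ z"
      "last_same_horiz \<nu> u (length u1) (length (u1 @ [N] @ v1 @ [E]))"
      unfolding path_diagonal_contraction_def by blast
    have "length u = Suc (length v)" by (simp add: eq(1,2))
    then show ?thesis
      using diagonal_contraction[OF assms(1)[unfolded eq(1)] eq(3)[unfolded eq(1)]] unfolding eq(1,2) by blast
  qed
  then obtain q where q: "tree_of u start = insert q (tree_of v start)"
    and v: "admissible v start" "length u = Suc (length v)" by blast
  have "card (tree_of u start) = Suc (card (tree_of v start))"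
    using card_tree_of[OF good_start] assms(1) v by simp
  then have "q \<notin> tree_of v start" using q by (auto simp: insert_absorb)
  then show ?thesis using q by (intro bexI[of _ q]) auto
qed

section \<open>Finding the contraction that deletes a given point\<close>

text \<open>Pushed columns always lie beyond the width of the current row, so a column once popped
  never comes back.\<close>

lemma column_gone:
  assumes "good s" "fitting u s" "c \<notin> set (fst s)" "c \<le> w (snd s)"
  shows "c \<notin> set (fst (run u s))" "(c, q) \<notin> visited u s"
proof -
  have "c \<notin> set (fst (run u s)) \<and> (c, q) \<notin> visited u s"
    using assms
  proof (induction u arbitrary: s)
    case (Cons x u)
    obtain d st y where s: "s = (d # st, y)" using good_cases[OF Cons.prems(1)] .
    have "c \<notin> set (fst (advance x s))" "c \<le> w (snd (advance x s))"
      using Cons.prems(3,4) w_le_Suc[of y] unfolding s by (cases x; auto)+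
    then show ?case
      using Cons.IH[of "advance x s"] Cons.prems good_advance by (auto simp: s)
  qed simp
  then show "c \<notin> set (fst (run u s))" "(c, q) \<notin> visited u s" by auto
qed

lemma visited_row:
  assumes "(p, q) \<in> visited u s"
  shows "q \<le> snd (run u s)"
  using assms
proof (induction u arbitrary: s)
  case (Cons x u)
  then consider "(p, q) = node s" | "(p, q) \<in> visited u (advance x s)" by auto
  then show ?case
  proof cases
    case 1
    then show ?thesis using snd_run[of "x # u" s] by (simp add: node_def)
  next
    case 2
    then show ?thesis using Cons.IH by simp
  qed
qed simp

lemma node_take_visited: "l < length u \<Longrightarrow> node (run (take l u) s) \<in> visited u s"
proof (induction u arbitrary: s l)
  case (Cons x u)
  then show ?case by (cases l) auto
qed simp

lemma tree_of_split: "q \<in> tree_of u s \<Longrightarrow> \<exists>u1 u2. u = u1 @ u2 \<and> q = node (run u1 s)"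
proof (induction u arbitrary: s)
  case (Cons x u)
  show ?case
  proof (cases "q = node s")
    case True
    then show ?thesis by (intro exI[of _ "[]"] exI[of _ "x # u"]) simp
  next
    case False
    then obtain u1 u2 where "u = u1 @ u2" "q = node (run u1 (advance x s))"
      using Cons.IH[of "advance x s"] Cons.prems by auto
    then show ?thesis by (intro exI[of _ "x # u1"] exI[of _ u2]) simp
  qed
qed simp

text \<open>Take the latest earlier visit to column \<open>c\<close>. The step there is
  \<open>N\<close>, because any other step would discard \<open>c\<close>; the scan then works
  strictly above \<open>c\<close> until \<open>c\<close> is on top again.\<close>

lemma visited_column:
  assumes "good s" "fitting u s" "run u s = (c # st, y)" "\<exists>q. (c, q) \<in> visited u s"
  shows "\<exists>u' v y'. u = u' @ N # v \<and> run u' s = (c # st, y') \<and>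
    (\<forall>l<length v. Suc (length st) < length (fst (run (u' @ N # take l v) s)))"
  using assms
proof (induction u arbitrary: s)
  case (Cons x u)
  obtain d st0 y0 where s: "s = (d # st0, y0)" using good_cases[OF Cons.prems(1)] .
  have good: "good (advance x s)" "fitting u (advance x s)"
    using Cons.prems good_advance by auto
  show ?case
  proof (cases "\<exists>q. (c, q) \<in> visited u (advance x s)")
    \<comment> \<open>A later visit exists, so the induction hypothesis finds the latest
      one.\<close>
    case True
    then obtain u' v y' where "u = u' @ N # v" "run u' (advance x s) = (c # st, y')"
      "\<forall>l<length v. Suc (length st) < length (fst (run (u' @ N # take l v) (advance x s)))"
      using Cons.IH[OF good] Cons.prems(3) by auto
    then show ?thesis by (intro exI[of _ "x # u'"] exI[of _ v] exI[of _ y']) simp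
  next
    case False
    then have q: "d = c" using Cons.prems(4) by (auto simp: s)
    note g = good_ConsD[OF Cons.prems(1)[unfolded s]]
    have end': "run u (advance x s) = (c # st, y)" using Cons.prems(3) by simp
    have "x = N"
    proof (rule ccontr)
      assume "x \<noteq> N"
      then have "c \<notin> set (fst (advance x s))" "c \<le> w (snd (advance x s))"
        using g w_le_Suc[of y0] unfolding s q by (cases x; auto)+
      then show False using column_gone(1)[OF good] end' by force
    qed
    then have adv: "advance x s = (fresh y0 @ c # st0, Suc y0)" by (simp add: s q)
    have "fst (run (take l u) (fresh y0 @ c # st0, Suc y0)) \<noteq> c # st0" if "l < length u" for l
      using node_take_visited[OF that, of "advance x s"] False unfolding adv
      by (metis list.sel(1) node_def)
    from run_above[OF this] obtain B y' where B: "run u (advance x s) = (B @ c # st0, y')"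
      "\<forall>l<length u. Suc (length st0) < length (fst (run (take l u) (advance x s)))"
      unfolding adv by (metis length_Cons)
    \<comment> \<open>Otherwise \<open>c\<close> would occur twice in a strictly decreasing
      stack.\<close>
    have "B = []"
    proof (rule ccontr)
      assume "B \<noteq> []"
      then obtain B' where "B = c # B'" using B(1) end' by (cases B) auto
      then show False using good_run[OF good] B(1) by (auto simp: good_def sorted_wrt_append)
    qed
    then show ?thesis
      using B end' \<open>x = N\<close> by (intro exI[of _ "[]"] exI[of _ u]) (auto simp: s q)
  qed
qed simp

lemma removal_is_contraction:
  assumes m: "admissible m start" and q: "q \<in> tree_of m start"
    and T: "partial_tree start (tree_of m start - {q})"
  shows "\<exists>k. path_contraction \<nu> m k \<and> admissible k start \<and>
    tree_of m start = insert q (tree_of k start)"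
proof -
  from tree_of_split[OF q] obtain u u2 where u: "m = u @ u2" "q = node (run u start)"
    by blast
  have f: "fitting u start" "admissible u2 (run u start)"
    using m by (auto simp: u admissible_append)
  have good: "good (run u start)" using good_run[OF good_start f(1)] .
  obtain c st y where s: "run u start = (c # st, y)" using good_cases[OF good] .
  have qc: "q = (c, y)" by (simp add: u s)
  note g = good_ConsD[OF good[unfolded s]]
  let ?T = "tree_of m start"
  have "c \<le> b" using g w_le_top[of y] by simp
  then have "c \<in> set (fst start) \<or> w (snd start) < c \<and> c \<le> b"
    by (auto simp: start_def simp del: upt_Suc)
  then obtain y2 where y2: "(c, y2) \<in> ?T" "y2 \<noteq> y"
    using partial_treeD(7,8)[OF T, of c] qc by blast
  obtain x2 where x2: "(x2, y) \<in> ?T" "x2 \<noteq> c"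
    using partial_treeD(9)[OF T, of y] g(2) qc by (auto simp: start_def)
  \<comment> \<open>The last node of the scan is the root, which cannot be deleted.\<close>
  have "u2 \<noteq> []"
  proof
    assume "u2 = []"
    then have "st = []" "y = a" using f(2) by (auto simp: s)
    then have "q = (0, a)" using g(5) qc by simp
    then show False using partial_treeD(6)[OF T] by simp
  qed
  then obtain z v where z: "u2 = z # v" by (cases u2) auto
  have fz: "fits z (c # st, y)" "admissible v (advance z (c # st, y))"
    using f(2) by (auto simp: z s)
  have "partial_tree (advance z (c # st, y)) (tree_of v (advance z (c # st, y)))"
    using partial_tree_tree_of[OF good_advance[OF good[unfolded s] fz(1)] fz(2)] .
  note above = partial_tree_above[OF good[unfolded s] fz(1) this]
  have T_eq: "?T = visited u start \<union> insert (c, y) (tree_of v (advance z (c # st, y)))"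
    by (simp add: u z s tree_of_append)
  have prev: "\<exists>u'. u = u' @ [E]" if "z \<noteq> E"
  proof -
    have x2u: "(x2, y) \<in> visited u start"
      using x2 above(2) that unfolding T_eq by auto
    then have "u \<noteq> []" by auto
    then obtain u' x where u': "u = u' @ [x]" by (metis append_butlast_last_id)
    have y': "snd (run u' start) + (if x = E then 0 else 1) = y"
      using s by (cases "run u' start"; cases x) (auto simp: u')
    have "y \<le> snd (run u' start)"
      using x2u visited_row[of x2 y u' start] by (auto simp: u' visited_append node_def)
    with y' have "x = E" by (auto split: if_splits)
    then show ?thesis using u' by blast
  qed
  have col: "\<exists>u' v'. u = u' @ N # v' \<and>
      length (fst (run (u' @ N # v') start)) = length (fst (run u' start)) \<and>
      (\<forall>l<length v'. length (fst (run (u' @ N # take l v') start)) \<noteq> length (fst (run u' start)))"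
    if "z \<noteq> N"
  proof -
    have "(c, y2) \<in> visited u start"
      using y2 above(3) that unfolding T_eq by auto
    then obtain u' v' y' where "u = u' @ N # v'" "run u' start = (c # st, y')"
      "\<forall>l<length v'. Suc (length st) < length (fst (run (u' @ N # take l v') start))"
      using visited_column[OF good_start f(1) s] by blast
    then show ?thesis using s by (intro exI[of _ u'] exI[of _ v']) auto
  qed
  show ?thesis
  proof (cases z)
    case N
    then obtain u' where u': "u = u' @ [E]" using prev by auto
    have m_eq: "m = u' @ [E, N] @ v" by (simp add: u u' z N)
    moreover have "path_contraction \<nu> m (u' @ [D] @ v)"
      unfolding path_contraction_def path_right_contraction_def m_eq by blast
    ultimately show ?thesis
      using right_contraction[of u' v] m u(2)[unfolded u'] by blast
  next
    case E
    then obtain u' v' where u': "u = u' @ N # v'"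
      and len: "length (fst (run (u' @ N # v') start)) = length (fst (run u' start))"
      "\<forall>l<length v'. length (fst (run (u' @ N # take l v') start)) \<noteq> length (fst (run u' start))"
      using col by auto
    have m_eq: "m = u' @ [N] @ v' @ [E] @ v" by (simp add: u u' z E)
    have last: "last_same_horiz \<nu> (u' @ [N] @ v' @ [E] @ v) (length u') (length (u' @ [N] @ v'))"
      using last_same_horiz_iff[of u' v' "[E] @ v"] m[unfolded m_eq] len by simp
    moreover from this have "path_contraction \<nu> m (u' @ [D] @ v' @ v)"
      unfolding path_contraction_def path_left_contraction_def m_eq by blast
    ultimately show ?thesis
      using left_contraction[OF m[unfolded m_eq] last] u(2)[unfolded u'] m_eq
      by (intro exI[of _ "u' @ [D] @ v' @ v"]) simp
  next
    case D
    then obtain u' v'' where u': "u = u' @ N # v''"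
      and len: "length (fst (run (u' @ N # v'') start)) = length (fst (run u' start))"
      "\<forall>l<length v''. length (fst (run (u' @ N # take l v'') start)) \<noteq> length (fst (run u' start))"
      using col by auto
    \<comment> \<open>Both facts apply before a \<open>D\<close> step. The \<open>E\<close> step
      into \<open>q\<close> comes after the \<open>N\<close> step, so it is the last letter of
      \<open>v''\<close>.\<close>
    obtain u'' where "u = u'' @ [E]" using prev D by auto
    then obtain v' where v'': "v'' = v' @ [E]"
      using u' by (cases v'' rule: rev_cases) auto
    have m_eq: "m = u' @ [N] @ v' @ [E, D] @ v" by (simp add: u u' z D v'')
    have last: "last_same_horiz \<nu> (u' @ [N] @ v' @ [E, D] @ v) (length u')
        (length (u' @ [N] @ v' @ [E]))"
      using last_same_horiz_iff[of u' v'' "[D] @ v"] m[unfolded m_eq] len by (simp add: v'')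
    moreover from this have "path_contraction \<nu> m (u' @ [D] @ v' @ [D] @ v)"
      unfolding path_contraction_def path_diagonal_contraction_def m_eq by blast
    ultimately show ?thesis
      using diagonal_contraction[OF m[unfolded m_eq] last] u(2)[unfolded u'] m_eq
      by (intro exI[of _ "u' @ [D] @ v' @ [D] @ v"]) (simp add: v'')
  qed
qed

text \<open>For the converse, the contraction found for \<open>q\<close> has the same tree as
  \<open>k\<close>, and injectivity identifies the two paths.\<close>

lemma path_contraction_iff:
  assumes "admissible m start" "admissible k start"
  shows "path_contraction \<nu> m k \<longleftrightarrow> (\<exists>q\<in>tree_of m start. tree_of k start = tree_of m start - {q})"
proof
  assume "\<exists>q\<in>tree_of m start. tree_of k start = tree_of m start - {q}"
  then obtain q where q: "q \<in> tree_of m start" "tree_of k start = tree_of m start - {q}" by blast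
  have "partial_tree start (tree_of m start - {q})"
    using partial_tree_tree_of[OF good_start assms(2)] q by simp
  from removal_is_contraction[OF assms(1) q(1) this] obtain k' where
    k': "path_contraction \<nu> m k'" "admissible k' start" "tree_of m start = insert q (tree_of k' start)"
    by blast
  obtain q' where q': "q' \<in> tree_of m start" "tree_of k' start = tree_of m start - {q'}"
    using path_contraction_removes[OF assms(1) k'(1)] by blast
  with k'(3) have "tree_of k' start = tree_of k start" using q by auto
  then have "k' = k" using tree_of_inj[OF good_start k'(2) assms(2)] by blast
  then show "path_contraction \<nu> m k" using k'(1) by simp
qed (fact path_contraction_removes[OF assms(1)])

section \<open>Contractions of trees\<close>

text \<open>If a tree remains, \<open>q\<close> has companions in its row and in its column. Above
  and left exclude each other, which leaves above with right, left with below, or neither above nor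
  left; the last case is diagonal.\<close>

lemma tree_contraction_iff:
  assumes S: "schroeder_tree \<nu> S" and S': "schroeder_tree \<nu> S'"
  shows "tree_contraction \<nu> S S' \<longleftrightarrow> (\<exists>q\<in>S. S' = S - {q})"
proof
  assume "tree_contraction \<nu> S S'"
  then show "\<exists>q\<in>S. S' = S - {q}"
    unfolding tree_contraction_def tree_right_contraction_def tree_left_contraction_def
      tree_diagonal_contraction_def by blast
next
  assume "\<exists>q\<in>S. S' = S - {q}"
  then obtain x y where q: "(x, y) \<in> S" "S' = S - {(x, y)}" by auto
  let ?q = "(x, y)"
  have reg: "S \<subseteq> region \<nu>" using S by (simp add: schroeder_tree_def)
  then have xy: "x \<le> b" "y \<le> a" using q(1) by (auto simp: region_def endpoint_nu)
  obtain y' where y': "(x, y') \<in> S" "y' \<noteq> y"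
    using S' xy(1) unfolding schroeder_tree_def endpoint_nu q(2) by auto
  obtain x' where x': "(x', y) \<in> S" "x' \<noteq> x"
    using S' xy(2) unfolding schroeder_tree_def endpoint_nu q(2) by auto
  \<comment> \<open>\<open>(x, y)\<close> is the southeast corner of the rectangle spanned by a
    point to its left and a point above it.\<close>
  have excl: "above_in S ?q = {} \<or> left_in S ?q = {}"
  proof (rule ccontr)
    assume "\<not> ?thesis"
    then obtain p r where "(x, p) \<in> S" "y < p" "(r, y) \<in> S" "r < x"
      by (auto simp: above_in_def left_in_def)
    moreover from this have "(x, p) \<in> region \<nu>" "(r, y) \<in> region \<nu>" using reg by auto
    then have "incompatible \<nu> (r, y) (x, p)"
      using incompatible_iff[of r y x p] reg q(1) mem_region[of x y] calculation by auto
    ultimately show False using S by (auto simp: schroeder_tree_def)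
  qed
  have col: "above_in S ?q \<noteq> {} \<or> below_in S ?q \<noteq> {}"
    using y' linorder_neq_iff[of y' y] by (fastforce simp: above_in_def below_in_def)
  have row: "left_in S ?q \<noteq> {} \<or> right_in S ?q \<noteq> {}"
    using x' linorder_neq_iff[of x' x] by (fastforce simp: left_in_def right_in_def)
  show "tree_contraction \<nu> S S'"
  proof (cases "above_in S ?q = {} \<and> left_in S ?q = {}")
    case False
    then show ?thesis
      using excl col row q unfolding tree_contraction_def tree_right_contraction_def
        tree_left_contraction_def by blast
  next
    case True
    have nw: "strictly_nw p ?q" if p: "p \<in> S" "p \<noteq> ?q" "fst p \<le> x" "y \<le> snd p" for p
    proof -
      obtain e f where ef: "p = (e, f)" by fastforce
      have "e = x \<longrightarrow> f \<le> y" "f = y \<longrightarrow> x \<le> e" "e \<noteq> x \<or> f \<noteq> y"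
        using True p(1,2) by (auto simp: above_in_def left_in_def not_less ef)
      then have "e < x \<and> y < f" using p(3,4) unfolding ef fst_conv snd_conv by presburger
      then show ?thesis by (simp add: strictly_nw_def ef)
    qed
    define P where "P = {p \<in> S. strictly_nw p ?q}"
    have "(0, a) \<in> S" "(0, a) \<noteq> ?q"
      using S S' q(2) by (auto simp: schroeder_tree_def endpoint_nu)
    then have "(0, a) \<in> P" using nw[of "(0, a)"] xy by (auto simp: P_def)
    \<comment> \<open>A northwest point at minimal taxicab distance has an empty box, hence is the
      parent. The root guarantees that there is a candidate.\<close>
    then obtain p where p: "p \<in> P"
      "\<And>r. r \<in> P \<Longrightarrow> (x - fst p) + (snd p - y) \<le> (x - fst r) + (snd r - y)"
      using ex_has_least_nat[of "\<lambda>p. p \<in> P" _ "\<lambda>p. (x - fst p) + (snd p - y)"] by blast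
    have "r = p \<or> r = ?q" if "r \<in> rect p ?q \<inter> S" for r
    proof (rule ccontr)
      assume r: "\<not> ?thesis"
      have b: "fst p \<le> fst r" "fst r \<le> x" "y \<le> snd r" "snd r \<le> snd p" "r \<in> S"
        using that p(1) by (auto simp: rect_def P_def strictly_nw_def)
      then have "r \<in> P" using nw[of r] r by (auto simp: P_def)
      moreover from this have "fst r < x" "y < snd r" by (auto simp: P_def strictly_nw_def)
      ultimately have "fst r = fst p" "snd r = snd p" using p(2)[of r] b by auto
      then show False using r by (simp add: prod_eq_iff)
    qed
    then have box: "rect p ?q \<inter> S \<subseteq> {p, ?q}" by blast
    have p': "p \<in> S" "strictly_nw p ?q" using p(1) by (auto simp: P_def)
    then have "(fst p, y) \<in> rect p ?q" "(x, snd p) \<in> rect p ?q"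
      by (auto simp: rect_def strictly_nw_def)
    then have "(fst p, y) \<notin> S" "(x, snd p) \<notin> S"
      using box p'(2) by (cases p; fastforce simp: strictly_nw_def)+
    moreover have "is_parent S p ?q"
      using True p' box by (simp add: is_parent_def)
    ultimately have "tree_diagonal_contraction \<nu> S S'"
      using p' q S' unfolding tree_diagonal_contraction_def
      by (intro bexI[of _ ?q] bexI[of _ p]) simp_all
    then show ?thesis by (simp add: tree_contraction_def)
  qed
qed

lemma finite_schroeder_tree: "schroeder_tree \<nu> T \<Longrightarrow> finite T"
  using finite_partial_tree by (simp add: schroeder_tree_iff)

text \<open>Deleting any surplus point of \<open>T\<close> keeps a set between \<open>T'\<close> and
  \<open>T\<close>, hence a tree, so every inclusion splits into contractions.\<close>

lemma tree_poset_eq: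
  "tree_poset \<nu> = ({T. schroeder_tree \<nu> T},
     {(T, T'). schroeder_tree \<nu> T \<and> schroeder_tree \<nu> T' \<and> T' \<subseteq> T})"
proof -
  let ?c = "{(u, v). u \<in> {T. schroeder_tree \<nu> T} \<and> v \<in> {T. schroeder_tree \<nu> T} \<and>
    tree_contraction \<nu> u v}"
  have "T' \<subseteq> T" if "(T, T') \<in> ?c\<^sup>*" for T T'
    using that by induction (use tree_contraction_iff in auto)
  moreover have "(T, T') \<in> ?c\<^sup>*" if "schroeder_tree \<nu> T" "schroeder_tree \<nu> T'" "T' \<subseteq> T" for T T'
    using that
  proof (induction "card T" arbitrary: T rule: less_induct)
    case less
    show ?case
    proof (cases "T = T'")
      case False
      then obtain q where q: "q \<in> T" "q \<notin> T'" using less.prems(3) by blast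
      let ?T = "T - {q}"
      have T'_sub: "T' \<subseteq> ?T" using q less.prems(3) by blast
      have T: "schroeder_tree \<nu> ?T"
        using less.prems(1,2) T'_sub unfolding schroeder_tree_def by (intro conjI) blast+
      moreover have "card ?T < card T"
        using q(1) finite_schroeder_tree[OF less.prems(1)] by (meson card_Diff1_less)
      ultimately have "(?T, T') \<in> ?c\<^sup>*"
        using less q by (intro less.hyps) auto
      moreover have "(T, ?T) \<in> ?c"
        using tree_contraction_iff[OF less.prems(1) T] q less.prems(1) T by auto
      ultimately show ?thesis by (rule converse_rtrancl_into_rtrancl[rotated])
    qed simp
  qed
  ultimately show ?thesis
    unfolding tree_poset_def poset_of_cover_def by auto
qed

lemma is_poset_tree_poset: "is_poset (tree_poset \<nu>)"
  unfolding tree_poset_eq is_poset_def partial_order_on_def preorder_on_def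
  by (auto simp: refl_on_def trans_def antisym_def)

lemma tree_poset_isomorphic_path_poset: "poset_isomorphic (path_poset \<nu>) (tree_poset \<nu>)"
proof -
  have "is_poset (path_poset \<nu>)"
    unfolding path_poset_def
    by (rule is_poset_of_cover[where m = length])
      (auto simp: path_contraction_def path_right_contraction_def path_left_contraction_def
        path_diagonal_contraction_def)
  moreover have "path_contraction \<nu> u v \<longleftrightarrow> tree_contraction \<nu> (tree_of u start) (tree_of v start)"
    if "u \<in> {u. schroeder_path \<nu> u}" "v \<in> {u. schroeder_path \<nu> u}" for u v
  proof -
    have uv: "admissible u start" "admissible v start"
      using that by (auto simp: schroeder_path_iff_admissible)
    then have "schroeder_tree \<nu> (tree_of u start)" "schroeder_tree \<nu> (tree_of v start)"
      by (auto simp: schroeder_tree_iff partial_tree_tree_of[OF good_start])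
    then show ?thesis using path_contraction_iff[OF uv] tree_contraction_iff by simp
  qed
  ultimately show ?thesis
    using is_poset_tree_poset bij_betw_tree_of unfolding path_poset_def tree_poset_def
    by (intro poset_of_cover_isomorphic) auto
qed

end

section \<open>Forests and trees\<close>

text \<open>The indices are shifted because node \<open>k\<close> belongs to the step \<open>\<nu> ! (k - 2)\<close>, which leads from
  \<open>point \<nu> (k - 2)\<close> to \<open>point \<nu> (k - 1)\<close>.\<close>

definition column :: "step list \<Rightarrow> nat \<Rightarrow> nat" where
  "column \<nu> i = fst (point \<nu> (i - 1))"

definition row :: "step list \<Rightarrow> nat \<Rightarrow> nat" where
  "row \<nu> j = snd (point \<nu> (j - 2))"

definition arc_point :: "step list \<Rightarrow> nat \<times> nat \<Rightarrow> nat \<times> nat" where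
  "arc_point \<nu> = map_prod (column \<nu>) (row \<nu>)"

lemma left_nodes_bounds: "i \<in> left_nodes \<nu> \<Longrightarrow> 1 \<le> i \<and> i \<le> length \<nu> + 1"
  by (auto simp: left_nodes_def)

lemma right_nodes_bounds: "j \<in> right_nodes \<nu> \<Longrightarrow> 2 \<le> j \<and> j \<le> length \<nu> + 2"
  by (auto simp: right_nodes_def)

text \<open>For \<open>i > 1\<close> the step of node \<open>i\<close> is an \<open>E\<close> step
  ending at index \<open>i - 1\<close>, which is thus the first index in its column.\<close>

lemma left_node_step:
  assumes "i \<in> left_nodes \<nu>" "k < i - 1"
  shows "fst (point \<nu> k) < column \<nu> i"
proof -
  have i: "2 \<le> i" "i \<le> length \<nu> + 1" "\<nu> ! (i - 2) = E"
    using assms by (auto simp: left_nodes_def)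
  then have "point \<nu> (Suc (i - 2)) = (Suc (fst (point \<nu> (i - 2))), snd (point \<nu> (i - 2)))"
    by (subst point_Suc) auto
  moreover have "Suc (i - 2) = i - 1" using i by simp
  moreover have "fst (point \<nu> k) \<le> fst (point \<nu> (i - 2))"
    using assms(2) by (intro point_mono) simp
  ultimately show ?thesis by (simp add: column_def)
qed

text \<open>The step of node \<open>j\<close> is an \<open>N\<close> step starting at index
  \<open>j - 2\<close>, which is thus the last index in its row; for the final node no index
  \<open>k\<close> is left.\<close>

lemma right_node_step:
  assumes "j \<in> right_nodes \<nu>" "j - 2 < k" "k \<le> length \<nu>"
  shows "row \<nu> j < snd (point \<nu> k)"
proof -
  have j: "2 \<le> j" "j \<le> length \<nu> + 1" "\<nu> ! (j - 2) = N"
    using assms by (auto simp: right_nodes_def)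
  then have "snd (point \<nu> (Suc (j - 2))) = Suc (row \<nu> j)"
    by (subst point_Suc) (auto simp: row_def)
  moreover have "snd (point \<nu> (Suc (j - 2))) \<le> snd (point \<nu> k)"
    using assms(2) by (intro point_mono) simp
  ultimately show ?thesis by simp
qed

lemma column_less_iff:
  assumes "i \<in> left_nodes \<nu>" "i' \<in> left_nodes \<nu>"
  shows "column \<nu> i < column \<nu> i' \<longleftrightarrow> i < i'"
proof -
  have less: "column \<nu> i < column \<nu> i'" if "i \<in> left_nodes \<nu>" "i' \<in> left_nodes \<nu>" "i < i'" for i i'
    using left_node_step[of i' \<nu> "i - 1"] left_nodes_bounds[of i \<nu>] that by (auto simp: column_def)
  show ?thesis
    using less[of i i'] less[of i' i] assms by (metis less_asym linorder_neqE_nat)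
qed

lemma row_less_iff:
  assumes "j \<in> right_nodes \<nu>" "j' \<in> right_nodes \<nu>"
  shows "row \<nu> j < row \<nu> j' \<longleftrightarrow> j < j'"
proof -
  have less: "row \<nu> j < row \<nu> j'" if "j \<in> right_nodes \<nu>" "j' \<in> right_nodes \<nu>" "j < j'" for j j'
    using right_node_step[of j \<nu> "j' - 2"] right_nodes_bounds[of j \<nu>] right_nodes_bounds[of j' \<nu>] that
    unfolding row_def[of \<nu> j'] by linarith
  show ?thesis
    using less[of j j'] less[of j' j] assms by (metis less_asym linorder_neqE_nat)
qed

lemma inj_on_arc_point: "inj_on (arc_point \<nu>) (left_nodes \<nu> \<times> right_nodes \<nu>)"
proof -
  have "inj_on (column \<nu>) (left_nodes \<nu>)"
    by (rule inj_onI) (use column_less_iff in \<open>metis less_irrefl linorder_neqE_nat\<close>)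
  moreover have "inj_on (row \<nu>) (right_nodes \<nu>)"
    by (rule inj_onI) (use row_less_iff in \<open>metis less_irrefl linorder_neqE_nat\<close>)
  ultimately show ?thesis unfolding arc_point_def by (rule map_prod_inj_on)
qed

lemma fst_point_le: "fst (point \<nu> k) \<le> fst (endpoint \<nu>)"
  using point_mono(1)[of k "max k (length \<nu>)" \<nu>] by simp

lemma snd_point_le: "snd (point \<nu> k) \<le> snd (endpoint \<nu>)"
  using point_mono(2)[of k "max k (length \<nu>)" \<nu>] by simp

text \<open>\<nu> first meets the column of \<open>i\<close> at index \<open>i - 1\<close> and last
  meets the row of \<open>j\<close> at index \<open>j - 2\<close>. The point is above \<nu> iff the
  first index is at most the second.\<close>

lemma arc_point_in_region:
  assumes i: "i \<in> left_nodes \<nu>" and j: "j \<in> right_nodes \<nu>" and "i \<noteq> j"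
  shows "(column \<nu> i, row \<nu> j) \<in> region \<nu> \<longleftrightarrow> i < j"
proof
  assume "i < j"
  have "i - 1 \<le> length \<nu>" using left_nodes_bounds[OF i] by auto
  moreover have "snd (point \<nu> (i - 1)) \<le> snd (point \<nu> (j - 2))"
    using \<open>i < j\<close> by (intro point_mono) simp
  ultimately show "(column \<nu> i, row \<nu> j) \<in> region \<nu>"
    using fst_point_le[of "i - 1" \<nu>] snd_point_le[of "j - 2" \<nu>]
    by (auto simp: region_def column_def row_def intro!: exI[of _ "i - 1"])
next
  assume "(column \<nu> i, row \<nu> j) \<in> region \<nu>"
  then obtain k where k: "k \<le> length \<nu>" "fst (point \<nu> k) = column \<nu> i" "snd (point \<nu> k) \<le> row \<nu> j"
    by (auto simp: region_def)
  have "i - 1 \<le> k" using left_node_step[OF i, of k] k(2) by force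
  moreover have "k \<le> j - 2" using right_node_step[OF j _ k(1)] k(3) by force
  ultimately show "i < j"
    using left_nodes_bounds[OF i] right_nodes_bounds[OF j] \<open>i \<noteq> j\<close> by linarith
qed

lemma left_right_disjoint: "i \<in> left_nodes \<nu> \<Longrightarrow> j \<in> right_nodes \<nu> \<Longrightarrow> i \<noteq> j"
  by (auto simp: left_nodes_def right_nodes_def)

lemma column_image:
  assumes "set \<nu> \<subseteq> {N, E}"
  shows "column \<nu> ` left_nodes \<nu> = {..fst (endpoint \<nu>)}"
proof (intro equalityI subsetI)
  fix x
  assume x: "x \<in> {..fst (endpoint \<nu>)}"
  show "x \<in> column \<nu> ` left_nodes \<nu>"
  proof (cases x)
    case 0
    then have "x = column \<nu> 1" by (simp add: column_def)
    then show ?thesis by (simp add: left_nodes_def)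
  next
    case (Suc x')
    \<comment> \<open>At the first index reaching column \<open>x\<close> the preceding step is
      \<open>E\<close>, and this step belongs to node \<open>k + 1\<close>.\<close>
    define k where "k = (LEAST k. x \<le> fst (point \<nu> k))"
    have ex: "x \<le> fst (point \<nu> (length \<nu>))" using x by simp
    have k: "x \<le> fst (point \<nu> k)" "k \<le> length \<nu>"
      unfolding k_def by (rule LeastI[of "\<lambda>k. x \<le> fst (point \<nu> k)", OF ex], rule Least_le, rule ex)
    have "k \<noteq> 0" using k(1) Suc by (intro notI) simp
    then obtain l where l: "k = Suc l" by (cases k) auto
    then have lt: "fst (point \<nu> l) < x"
      using not_less_Least[of l "\<lambda>k. x \<le> fst (point \<nu> k)"] by (simp add: k_def not_le)
    have "l < length \<nu>" using k(2) l by simp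
    then have "\<nu> ! l \<in> {N, E}" using assms nth_mem by blast
    moreover have "fst (point \<nu> k) = fst (point \<nu> l) + (if \<nu> ! l = N then 0 else 1)"
      unfolding l point_Suc[OF \<open>l < length \<nu>\<close>] by simp
    ultimately have "\<nu> ! l = E" "fst (point \<nu> k) = x"
      using k(1) lt by (auto split: if_splits)
    then have "k + 1 \<in> left_nodes \<nu>" "column \<nu> (k + 1) = x"
      using l k(2) by (auto simp: left_nodes_def column_def)
    then show ?thesis by blast
  qed
qed (auto simp: column_def fst_point_le)

lemma row_image:
  assumes "set \<nu> \<subseteq> {N, E}"
  shows "row \<nu> ` right_nodes \<nu> = {..snd (endpoint \<nu>)}"
proof (intro equalityI subsetI)
  fix y
  assume y: "y \<in> {..snd (endpoint \<nu>)}"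
  show "y \<in> row \<nu> ` right_nodes \<nu>"
  proof (cases "y = snd (endpoint \<nu>)")
    case True
    \<comment> \<open>No \<open>N\<close> step leaves the top row; the extra node
      \<open>length \<nu> + 2\<close> stands for it.\<close>
    then have "y = row \<nu> (length \<nu> + 2)" by (simp add: row_def)
    then show ?thesis by (simp add: right_nodes_def)
  next
    case False
    define k where "k = (LEAST k. y < snd (point \<nu> k))"
    have ex: "y < snd (point \<nu> (length \<nu>))" using y False by simp
    have k: "y < snd (point \<nu> k)" "k \<le> length \<nu>"
      unfolding k_def by (rule LeastI[of "\<lambda>k. y < snd (point \<nu> k)", OF ex], rule Least_le, rule ex)
    have "k \<noteq> 0" using k(1) by (intro notI) simp
    then obtain l where l: "k = Suc l" by (cases k) auto
    then have le: "snd (point \<nu> l) \<le> y"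
      using not_less_Least[of l "\<lambda>k. y < snd (point \<nu> k)"] by (simp add: k_def not_less)
    have "l < length \<nu>" using k(2) l by simp
    then have "\<nu> ! l \<in> {N, E}" using assms nth_mem by blast
    moreover have "snd (point \<nu> k) = snd (point \<nu> l) + (if \<nu> ! l = E then 0 else 1)"
      unfolding l point_Suc[OF \<open>l < length \<nu>\<close>] by simp
    ultimately have "\<nu> ! l = N" "snd (point \<nu> l) = y"
      using k(1) le by (auto split: if_splits)
    then have "l + 2 \<in> right_nodes \<nu>" "row \<nu> (l + 2) = y"
      using \<open>l < length \<nu>\<close> by (auto simp: right_nodes_def row_def)
    then show ?thesis by blast
  qed
qed (auto simp: row_def snd_point_le)

context staircase
begin

lemma covering_forest_iff:
  assumes nu: "set \<nu> \<subseteq> {N, E}" and F: "F \<subseteq> left_nodes \<nu> \<times> right_nodes \<nu>"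
  shows "covering_forest \<nu> F \<longleftrightarrow> schroeder_tree \<nu> (arc_point \<nu> ` F)"
proof -
  have L: "i \<in> left_nodes \<nu>" and R: "j \<in> right_nodes \<nu>" if "(i, j) \<in> F" for i j
    using F that by auto
  have mem: "arc_point \<nu> (i, j) \<in> region \<nu> \<longleftrightarrow> i < j" if "i \<in> left_nodes \<nu>" "j \<in> right_nodes \<nu>" for i j
    using arc_point_in_region[OF that] left_right_disjoint[OF that] by (simp add: arc_point_def)
  have increasing: "(\<forall>(i, j)\<in>F. i < j) \<longleftrightarrow> arc_point \<nu> ` F \<subseteq> region \<nu>"
  proof -
    have "i < j \<longleftrightarrow> arc_point \<nu> (i, j) \<in> region \<nu>" if "(i, j) \<in> F" for i j
      using mem[OF L[OF that] R[OF that]] by simp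
    then have "(\<forall>(i, j)\<in>F. i < j) \<longleftrightarrow> (\<forall>p\<in>F. arc_point \<nu> p \<in> region \<nu>)"
      by (intro ball_cong) auto
    then show ?thesis by (simp add: image_subset_iff)
  qed
  have incomp: "incompatible \<nu> (arc_point \<nu> (i, j)) (arc_point \<nu> (i', j')) \<longleftrightarrow>
      i < i' \<and> i' < j \<and> j < j' \<or> i' < i \<and> i < j' \<and> j' < j"
    if "(i, j) \<in> F" "(i', j') \<in> F" "arc_point \<nu> ` F \<subseteq> region \<nu>" for i j i' j'
  proof -
    note nodes = L[OF that(1)] R[OF that(1)] L[OF that(2)] R[OF that(2)]
    have reg: "(column \<nu> i, row \<nu> j) \<in> region \<nu>" "(column \<nu> i', row \<nu> j') \<in> region \<nu>"
      using that by (force simp: arc_point_def)+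
    \<comment> \<open>The arc points of \<open>(i', j)\<close> and \<open>(i, j')\<close> are the
      southeast corners of the two possible rectangles. Testing them against the region yields the
      middle inequality of a crossing.\<close>
    have "column \<nu> i' \<le> w (row \<nu> j) \<longleftrightarrow> i' < j" "column \<nu> i \<le> w (row \<nu> j') \<longleftrightarrow> i < j'"
      using mem[of i' j] mem[of i j'] nodes reg by (simp_all add: arc_point_def mem_region)
    then show ?thesis
      using incompatible_iff[OF reg] nodes
      by (auto simp: arc_point_def column_less_iff row_less_iff)
  qed
  have crossing: "\<not> (\<exists>(i, j)\<in>F. \<exists>(i', j')\<in>F. i < i' \<and> i' < j \<and> j < j') \<longleftrightarrow>
      (\<forall>p\<in>arc_point \<nu> ` F. \<forall>q\<in>arc_point \<nu> ` F. \<not> incompatible \<nu> p q)"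
    if "arc_point \<nu> ` F \<subseteq> region \<nu>"
  proof -
    have "(\<forall>p\<in>arc_point \<nu> ` F. \<forall>q\<in>arc_point \<nu> ` F. \<not> incompatible \<nu> p q) \<longleftrightarrow>
        (\<forall>p\<in>F. \<forall>q\<in>F. \<not> incompatible \<nu> (arc_point \<nu> p) (arc_point \<nu> q))"
      by simp
    also have "\<dots> \<longleftrightarrow> (\<forall>(i, j)\<in>F. \<forall>(i', j')\<in>F.
        \<not> (i < i' \<and> i' < j \<and> j < j' \<or> i' < i \<and> i < j' \<and> j' < j))"
      using incomp[OF _ _ that] by (intro ball_cong refl) auto
    also have "\<dots> \<longleftrightarrow> \<not> (\<exists>(i, j)\<in>F. \<exists>(i', j')\<in>F. i < i' \<and> i' < j \<and> j < j')"
      by (simp add: Ball_def Bex_def) blast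
    finally show ?thesis by simp
  qed
  have corner: "1 \<in> left_nodes \<nu>" "length \<nu> + 2 \<in> right_nodes \<nu>"
    by (auto simp: left_nodes_def right_nodes_def)
  have "arc_point \<nu> (1, length \<nu> + 2) = (0, a)"
    by (simp add: arc_point_def column_def row_def endpoint_nu)
  then have root: "(1, length \<nu> + 2) \<in> F \<longleftrightarrow> (0, a) \<in> arc_point \<nu> ` F"
    using inj_on_image_mem_iff[OF inj_on_arc_point, of "(1, length \<nu> + 2)" \<nu> F] F corner by auto
  have col: "(\<exists>y. (column \<nu> i, y) \<in> arc_point \<nu> ` F) \<longleftrightarrow> (\<exists>j. (i, j) \<in> F)"
    if "i \<in> left_nodes \<nu>" for i
  proof
    assume "\<exists>y. (column \<nu> i, y) \<in> arc_point \<nu> ` F"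
    then obtain i' j where "(i', j) \<in> F" "column \<nu> i' = column \<nu> i"
      by (auto simp: arc_point_def)
    then show "\<exists>j. (i, j) \<in> F"
      using column_less_iff[of i \<nu> i'] column_less_iff[of i' \<nu> i] L[of i' j] that
      by (metis less_irrefl linorder_neqE_nat)
  qed (force simp: arc_point_def)
  have row: "(\<exists>x. (x, row \<nu> j) \<in> arc_point \<nu> ` F) \<longleftrightarrow> (\<exists>i. (i, j) \<in> F)"
    if "j \<in> right_nodes \<nu>" for j
  proof
    assume "\<exists>x. (x, row \<nu> j) \<in> arc_point \<nu> ` F"
    then obtain i j' where "(i, j') \<in> F" "row \<nu> j' = row \<nu> j"
      by (auto simp: arc_point_def)
    then show "\<exists>i. (i, j) \<in> F"
      using row_less_iff[of j \<nu> j'] row_less_iff[of j' \<nu> j] R[of i j'] that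
      by (metis less_irrefl linorder_neqE_nat)
  qed (force simp: arc_point_def)
  have cols: "(\<forall>i\<in>left_nodes \<nu>. \<exists>j. (i, j) \<in> F) \<longleftrightarrow> (\<forall>x\<le>b. \<exists>y. (x, y) \<in> arc_point \<nu> ` F)"
  proof -
    have "(\<forall>x\<le>b. \<exists>y. (x, y) \<in> arc_point \<nu> ` F) \<longleftrightarrow>
        (\<forall>x\<in>column \<nu> ` left_nodes \<nu>. \<exists>y. (x, y) \<in> arc_point \<nu> ` F)"
      unfolding column_image[OF nu] endpoint_nu by auto
    then show ?thesis using col by simp
  qed
  have rows: "(\<forall>j\<in>right_nodes \<nu>. \<exists>i. (i, j) \<in> F) \<longleftrightarrow> (\<forall>y\<le>a. \<exists>x. (x, y) \<in> arc_point \<nu> ` F)"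
  proof -
    have "(\<forall>y\<le>a. \<exists>x. (x, y) \<in> arc_point \<nu> ` F) \<longleftrightarrow>
        (\<forall>y\<in>row \<nu> ` right_nodes \<nu>. \<exists>x. (x, y) \<in> arc_point \<nu> ` F)"
      unfolding row_image[OF nu] endpoint_nu by auto
    then show ?thesis using row by simp
  qed
  have "covering_forest \<nu> F \<longleftrightarrow> arc_point \<nu> ` F \<subseteq> region \<nu> \<and>
      \<not> (\<exists>(i, j)\<in>F. \<exists>(i', j')\<in>F. i < i' \<and> i' < j \<and> j < j') \<and> (0, a) \<in> arc_point \<nu> ` F \<and>
      (\<forall>x\<le>b. \<exists>y. (x, y) \<in> arc_point \<nu> ` F) \<and> (\<forall>y\<le>a. \<exists>x. (x, y) \<in> arc_point \<nu> ` F)"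
    unfolding covering_forest_def forest_def increasing root cols rows using F by argo
  also have "\<dots> \<longleftrightarrow> schroeder_tree \<nu> (arc_point \<nu> ` F)"
    unfolding schroeder_tree_def endpoint_nu fst_conv snd_conv using crossing by argo
  finally show ?thesis .
qed

lemma forest_poset_isomorphic_tree_poset:
  assumes nu: "set \<nu> \<subseteq> {N, E}"
  shows "poset_isomorphic (forest_poset \<nu>) (tree_poset \<nu>)"
proof -
  let ?A = "left_nodes \<nu> \<times> right_nodes \<nu>" and ?f = "\<lambda>F. arc_point \<nu> ` F"
  have sub: "F \<subseteq> ?A" if "covering_forest \<nu> F" for F
    using that by (simp add: covering_forest_def forest_def)
  have "is_poset (forest_poset \<nu>)"
    unfolding forest_poset_def is_poset_def partial_order_on_def preorder_on_def
    by (auto simp: refl_on_def trans_def antisym_def)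
  moreover have "bij_betw ?f {F. covering_forest \<nu> F} {T. schroeder_tree \<nu> T}"
  proof (rule bij_betw_imageI)
    show "inj_on ?f {F. covering_forest \<nu> F}"
    proof (rule inj_onI)
      fix F F'
      assume "F \<in> {F. covering_forest \<nu> F}" "F' \<in> {F. covering_forest \<nu> F}" "?f F = ?f F'"
      then show "F = F'"
        using inj_on_image_eq_iff[OF inj_on_arc_point, of F \<nu> F'] sub[of F] sub[of F'] by simp
    qed
    show "?f ` {F. covering_forest \<nu> F} = {T. schroeder_tree \<nu> T}"
    proof (intro equalityI subsetI)
      fix T
      assume "T \<in> {T. schroeder_tree \<nu> T}"
      then have T: "schroeder_tree \<nu> T" by simp
      define F where "F = {p \<in> ?A. arc_point \<nu> p \<in> T}"
      have "T \<subseteq> {..b} \<times> {..a}"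
        using T by (auto simp: schroeder_tree_def region_def endpoint_nu)
      also have "\<dots> = arc_point \<nu> ` ?A"
        using column_image[OF nu] row_image[OF nu]
        by (simp add: arc_point_def map_prod_surj_on endpoint_nu)
      finally have T_eq: "T = ?f F" by (auto simp: F_def)
      have "F \<subseteq> ?A" by (auto simp: F_def)
      from covering_forest_iff[OF nu this] have "covering_forest \<nu> F"
        using T unfolding T_eq by blast
      with T_eq show "T \<in> ?f ` {F. covering_forest \<nu> F}" by blast
    next
      fix T
      assume "T \<in> ?f ` {F. covering_forest \<nu> F}"
      then obtain F where "T = ?f F" "covering_forest \<nu> F" by blast
      then show "T \<in> {T. schroeder_tree \<nu> T}"
        using covering_forest_iff[OF nu sub[of F]] by simp
    qed
  qed
  moreover have "(F, F') \<in> snd (forest_poset \<nu>) \<longleftrightarrow> (?f F, ?f F') \<in> snd (tree_poset \<nu>)"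
    if "covering_forest \<nu> F" "covering_forest \<nu> F'" for F F'
  proof -
    have "schroeder_tree \<nu> (?f F)" "schroeder_tree \<nu> (?f F')"
      using covering_forest_iff[OF nu] sub that by blast+
    then show ?thesis
      using inj_on_image_subset_iff[OF inj_on_arc_point sub[OF that(2)] sub[OF that(1)]] that
      by (simp add: forest_poset_def tree_poset_eq)
  qed
  moreover have "fst (forest_poset \<nu>) = {F. covering_forest \<nu> F}"
    "fst (tree_poset \<nu>) = {T. schroeder_tree \<nu> T}"
    by (simp_all add: forest_poset_def tree_poset_eq)
  ultimately show ?thesis
    using is_poset_tree_poset unfolding poset_isomorphic_def
    by (intro conjI exI[of _ ?f]) simp_all
qed

end

theorem theorem4p7:
  fixes \<nu> :: "step list" and a b :: nat
  assumes "lattice_path \<nu> b a"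
  shows "(\<forall>\<C> :: 'a::euclidean_space set set. nu_associahedron \<nu> \<C> \<longrightarrow>
            poset_isomorphic (face_poset \<C>) (tree_poset \<nu>) \<and>
            poset_isomorphic (face_poset \<C>) (path_poset \<nu>)) \<and>
         poset_isomorphic (forest_poset \<nu>) (tree_poset \<nu>) \<and>
         poset_isomorphic (forest_poset \<nu>) (path_poset \<nu>) \<and>
         poset_isomorphic (tree_poset \<nu>) (path_poset \<nu>)"
proof -
  have nu: "set \<nu> \<subseteq> {N, E}" "endpoint \<nu> = (b, a)"
    using assms by (auto simp: lattice_path_def)
  obtain w where "staircase \<nu> w b a" using staircase_exists[OF nu(2)] by blast
  then interpret staircase \<nu> w b a .
  have tree: "poset_isomorphic (forest_poset \<nu>) (tree_poset \<nu>)"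
    using forest_poset_isomorphic_tree_poset[OF nu(1)] .
  have path: "poset_isomorphic (tree_poset \<nu>) (path_poset \<nu>)"
    using tree_poset_isomorphic_path_poset by (rule poset_isomorphic_sym)
  \<comment> \<open>The complex enters only through its face poset, which by definition is
    isomorphic to the forest poset.\<close>
  have face: "poset_isomorphic (face_poset \<C>) (tree_poset \<nu>)"
    if "nu_associahedron \<nu> \<C>" for \<C> :: "'a set set"
    using that poset_isomorphic_trans[OF _ tree] unfolding nu_associahedron_def by blast
  show ?thesis
    using tree path face[THEN poset_isomorphic_trans, OF _ path] face
      poset_isomorphic_trans[OF tree path] by blast
qed

end
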